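(* Let $\sigma_a,\sigma_z>0$ and $0<w_{\min}\le w_{\max}<\infty$ be constants. Let $(k_m)_{m\ge1}$ and $(n_m)_{m\ge 1}$ be sequences of positive integers with $k_m\le m$, and let $\{\mathbf{w}^{(m)}\}_{m=1}^\infty$ be a sequence of vectors with $\mathbf{w}^{(m)}\in\mathbb{R}^{k_m}$ and $w_{\min}\le|w^{(m)}_j|\le w_{\max}$ for all $j\in[k_m]$, $m\ge1$. Let $A^{(m)}\in\mathbb{R}^{n_m\times m}$ be a random matrix with i.i.d. entries $A^{(m)}_{ij}\sim\mathcal{N}(0,\sigma_a^2)$. If $$\limsup_{m\to\infty}\frac{1}{n_m}\max_{j\in[k_m]}\left[\frac{6k_m\log k_m+2j\log m}{\log\left(\frac{j\,w_{\min}^2\sigma_a^2}{\sigma_z^2}+1\right)}\right]<1,$$ then there exists a sequence of support recovery maps $\{d^{(m)}\}_{m=1}^\infty$, $d^{(m)}:\mathbb{R}^{n_m}\to2^{[m]}$ (where $d^{(m)}$ may depend on the realization of $A^{(m)}$), such that $$\lim_{m\to\infty}\mathsf{P}\left\{d^{(m)}\big(A^{(m)}\mathbf{X}(\mathbf{w}^{(m)},\mathbf{S})+\mathbf{Z}\big)\neq\mathrm{supp}\big(\mathbf{X}(\mathbf{w}^{(m)},\mathbf{S})\big)\right\}=0 .$$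
   Context: Notation: $[m]=\{1,\dots,m\}$, $2^{[m]}$ is the set of subsets of $[m]$. The base of $\log$ is the same everywhere (and is then immaterial). For each $m$, $\mathbf{S}=(S_1,\dots,S_{k_m})$ is chosen uniformly at random from $[m]$ without replacement (uniform over ordered $k_m$-tuples of distinct elements). The signal $\mathbf{X}=\mathbf{X}(\mathbf{w}^{(m)},\mathbf{S})\in\mathbb{R}^m$ has $X_s=w^{(m)}_j$ if $s=S_j$, and $X_s=0$ if $s\notin\{S_1,\dots,S_{k_m}\}$; so $\mathrm{supp}(\mathbf{X})=\{S_1,\dots,S_{k_m}\}$. The noise $\mathbf{Z}\in\mathbb{R}^{n_m}$ has i.i.d. $\mathcal{N}(0,\sigma_z^2)$ entries. The matrix $A^{(m)}$, $\mathbf{S}$ and $\mathbf{Z}$ are mutually independent, and the probability is over all three. A support recovery map produces an estimate of the support from the measurement vector; the measurement matrix is known to the decoder, so formally the estimate is a measurable function of the pair (measurement vector, $A^{(m)}$). *)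

theory Defs
  imports "HOL-Probability.Probability"
begin

text \<open>
  Vectors in \<open>\<real>\<^sup>n\<close> are the extensional functions on \<open>{1..n}\<close>, and \<open>n \<times> m\<close> matrices the extensional
  functions on \<open>{1..n} \<times> {1..m}\<close>, i.e. the elements of the space of the corresponding \<open>Pi\<^sub>M\<close>.
\<close>

definition vec_borel :: "nat \<Rightarrow> (nat \<Rightarrow> real) measure" where
  "vec_borel n = Pi\<^sub>M {1..n} (\<lambda>_. borel)"

definition mat_borel :: "nat \<Rightarrow> nat \<Rightarrow> (nat \<times> nat \<Rightarrow> real) measure" where
  "mat_borel n m = Pi\<^sub>M ({1..n} \<times> {1..m}) (\<lambda>_. borel)"

text \<open>The second argument of \<^const>\<open>normal_density\<close> is the standard deviation, not the variance.\<close>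

definition gaussian :: "real \<Rightarrow> real measure" where
  "gaussian \<sigma> = density lborel (normal_density 0 \<sigma>)"

definition injective_tuples :: "nat \<Rightarrow> nat \<Rightarrow> (nat \<Rightarrow> nat) set" where
  "injective_tuples k m = {S \<in> {1..k} \<rightarrow>\<^sub>E {1..m}. inj_on S {1..k}}"

text \<open>
  The joint law of \<open>(A, S, Z)\<close>: independence of the three components, and of the entries of \<open>A\<close>
  and of \<open>Z\<close>, is expressed by taking product measures.
\<close>

definition model :: "real \<Rightarrow> real \<Rightarrow> nat \<Rightarrow> nat \<Rightarrow> nat \<Rightarrow>
    ((nat \<times> nat \<Rightarrow> real) \<times> (nat \<Rightarrow> nat) \<times> (nat \<Rightarrow> real)) measure" where
  "model \<sigma>\<^sub>a \<sigma>\<^sub>z n m k =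
     Pi\<^sub>M ({1..n} \<times> {1..m}) (\<lambda>_. gaussian \<sigma>\<^sub>a)
     \<Otimes>\<^sub>M (uniform_count_measure (injective_tuples k m) \<Otimes>\<^sub>M Pi\<^sub>M {1..n} (\<lambda>_. gaussian \<sigma>\<^sub>z))"

definition signal :: "nat \<Rightarrow> nat \<Rightarrow> (nat \<Rightarrow> real) \<Rightarrow> (nat \<Rightarrow> nat) \<Rightarrow> nat \<Rightarrow> real" where
  "signal m k w S = (\<lambda>s\<in>{1..m}. if s \<in> S ` {1..k} then w (the_inv_into {1..k} S s) else 0)"

definition supp :: "nat \<Rightarrow> (nat \<Rightarrow> real) \<Rightarrow> nat set" where
  "supp m X = {s \<in> {1..m}. X s \<noteq> 0}"

definition measurement :: "nat \<Rightarrow> nat \<Rightarrow> (nat \<times> nat \<Rightarrow> real) \<Rightarrow> (nat \<Rightarrow> real) \<Rightarrow> (nat \<Rightarrow> real) \<Rightarrow> nat \<Rightarrow> real" where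
  "measurement n m A X Z = (\<lambda>i\<in>{1..n}. (\<Sum>s\<in>{1..m}. A (i, s) * X s) + Z i)"

text \<open>
  A support recovery map receives the measurement vector and the measurement matrix.
\<close>

definition support_recovery_map ::
    "nat \<Rightarrow> nat \<Rightarrow> ((nat \<Rightarrow> real) \<Rightarrow> (nat \<times> nat \<Rightarrow> real) \<Rightarrow> nat set) \<Rightarrow> bool" where
  "support_recovery_map n m d \<longleftrightarrow>
     (\<lambda>(y, A). d y A) \<in> vec_borel n \<Otimes>\<^sub>M mat_borel n m \<rightarrow>\<^sub>M count_space (Pow {1..m})"

lemma finite_injective_tuples: "finite (injective_tuples k m)"
  unfolding injective_tuples_def by (rule finite_subset[of _ "{1..k} \<rightarrow>\<^sub>E {1..m}"]) (auto intro: finite_PiE)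

lemma injective_tuples_nonempty:
  assumes "k \<le> m"
  shows "injective_tuples k m \<noteq> {}"
proof -
  have "restrict id {1..k} \<in> injective_tuples k m"
    using assms by (auto simp: injective_tuples_def inj_on_def)
  then show ?thesis by blast
qed

lemma prob_space_gaussian: "\<sigma> > 0 \<Longrightarrow> prob_space (gaussian \<sigma>)"
  unfolding gaussian_def by (rule prob_space_normal_density)

lemma prob_space_model:
  assumes "\<sigma>\<^sub>a > 0" "\<sigma>\<^sub>z > 0" "k \<le> m"
  shows "prob_space (model \<sigma>\<^sub>a \<sigma>\<^sub>z n m k)"
  unfolding model_def
  by (intro prob_space_pair prob_space_PiM prob_space_gaussian prob_space_uniform_count_measure
      finite_injective_tuples injective_tuples_nonempty assms)

lemma supp_signal:
  assumes "S \<in> injective_tuples k m" "\<And>j. j \<in> {1..k} \<Longrightarrow> w j \<noteq> 0"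
  shows "supp m (signal m k w S) = S ` {1..k}"
proof -
  have "inj_on S {1..k}" "S ` {1..k} \<subseteq> {1..m}"
    using assms(1) by (auto simp: injective_tuples_def)
  then show ?thesis
    using assms(2) by (auto simp: supp_def signal_def the_inv_into_f_f)
qed

end

theory Submission
  imports Defs
begin

text \<open>
  The decoder may depend on \<open>w\<close>, so it tests every ordered tuple \<open>S'\<close> and accepts one whose residual
  \<open>y - A X(S')\<close> has squared norm at most \<open>n \<sigma>\<^sub>z\<^sup>2 (1 + \<delta>)\<close>. If \<open>S'\<close> misses a set \<open>R\<close> of \<open>j\<close> true indices and
  contains a set \<open>T\<close> of \<open>j\<close> false ones, this residual is \<open>V - W\<close>, where \<open>W\<close> is Gaussian, built from the columns
  in \<open>T\<close> and independent of \<open>V = U + h\<close>; here \<open>U\<close> consists of the noise and the columns in \<open>R\<close>, and \<open>h\<close> lies in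
  the span of the remaining at most \<open>k\<close> true columns. With high probability every such \<open>V\<close> has squared norm
  at least \<open>n\<close> times the variance of \<open>U\<close>, up to a factor \<open>1 - 2 \<delta>\<close>: the distance of \<open>U\<close> from a
  \<open>k\<close>-dimensional space controls all the (possibly \<open>k!\<close> many) assignments of wrong values to the common indices
  at once, and \<open>k = o(n)\<close>. A Chernoff bound over \<open>W\<close> for fixed \<open>V\<close> then gives the exponent
  \<open>n / 2 (ln (1 + j w\<^sub>m\<^sub>i\<^sub>n\<^sup>2 \<sigma>\<^sub>a\<^sup>2 / \<sigma>\<^sub>z\<^sup>2) - 3 \<delta>)\<close>, which beats the at most \<open>k\<^sup>k m\<^sup>j\<close> tuples with \<open>j\<close> false indices.
\<close>

section \<open>Gaussian moments and tails\<close>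

text \<open>The lower bound on \<open>V\<close> repays what the Chernoff step spends. Write
  \<open>p\<close> and \<open>p'\<close> for the powers of the missed and of the false columns
  divided by the noise power. Allowing a residual of about
  \<open>n * \<sigma>\<^sub>z\<^sup>2\<close> costs \<open>n / 2\<close> in the exponent; if nothing
  were known about \<open>V\<close>, only \<open>ln (1 + p') - 1\<close> would remain, which is
  negative for a weak signal. Averaging over \<open>W\<close> also leaves a Gaussian factor in
  \<open>V\<close>, and for large \<open>V\<close> it returns \<open>(1 + p) / (1 + p')\<close>.
  Here \<open>p\<close> and \<open>p'\<close> may differ, since the values on the two sets differ,
  but both are at least \<open>j * x\<close> with \<open>x\<close> the minimal signal-to-noise
  ratio, and \<open>ln t \<le> t - 1\<close> turns this into \<open>ln (1 + j * x)\<close>.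

  The two steps must be kept apart: the probability that \<open>V\<close> is small decays only at a
  rate depending on \<open>\<delta>\<close>, too slow for a union over all tuples. Hence that event
  is indexed by the missed set alone, which costs a factor \<open>2 ^ k\<close>.

  The term \<open>j = 1\<close> of the hypothesis, in which both \<open>k * ln k\<close> and
  \<open>ln m\<close> occur, gives that \<open>n\<close> tends to infinity and that
  \<open>k / n\<close> tends to 0.\<close>

lemma sets_gaussian [simp, measurable_cong]: "sets (gaussian \<sigma>) = sets borel"
  by (simp add: gaussian_def)

lemma space_gaussian [simp]: "space (gaussian \<sigma>) = UNIV"
  by (simp add: gaussian_def)

lemma sets_PiM_gaussian: "sets (Pi\<^sub>M I (\<lambda>i. gaussian (\<sigma> i))) = sets (Pi\<^sub>M I (\<lambda>_. borel))"
  by (intro sets_PiM_cong) auto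

lemma nn_integral_gaussian:
  assumes [measurable]: "f \<in> borel_measurable borel"
  shows "(\<integral>\<^sup>+x. f x \<partial>gaussian \<sigma>) = (\<integral>\<^sup>+x. ennreal (normal_density 0 \<sigma> x) * f x \<partial>lborel)"
  unfolding gaussian_def by (subst nn_integral_density) auto

lemma nn_integral_normal_density:
  assumes "\<sigma> > 0"
  shows "(\<integral>\<^sup>+x. ennreal (normal_density \<mu> \<sigma> x) \<partial>lborel) = 1"
  using assms by (subst nn_integral_eq_integral) auto

lemma nn_integral_gaussian_exp_linear:
  assumes s: "\<sigma> > 0"
  shows "(\<integral>\<^sup>+x. ennreal (exp (c * x)) \<partial>gaussian \<sigma>) = ennreal (exp (c\<^sup>2 * \<sigma>\<^sup>2 / 2))"
proof -
  \<comment> \<open>Completing the square: the exponential tilt moves the mean to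
    \<open>c * \<sigma>\<^sup>2\<close> and keeps the variance.\<close>
  have "normal_density 0 \<sigma> x * exp (c * x) = exp (c\<^sup>2 * \<sigma>\<^sup>2 / 2) * normal_density (c * \<sigma>\<^sup>2) \<sigma> x" for x
  proof -
    have "- (x - 0)\<^sup>2 / (2 * \<sigma>\<^sup>2) + c * x = c\<^sup>2 * \<sigma>\<^sup>2 / 2 + - (x - c * \<sigma>\<^sup>2)\<^sup>2 / (2 * \<sigma>\<^sup>2)"
      using s by (simp add: field_simps power2_eq_square)
    then show ?thesis
      unfolding normal_density_def by (simp add: exp_add[symmetric] mult_ac)
  qed
  then have "(\<integral>\<^sup>+x. ennreal (exp (c * x)) \<partial>gaussian \<sigma>) =
     (\<integral>\<^sup>+x. ennreal (exp (c\<^sup>2 * \<sigma>\<^sup>2 / 2)) * ennreal (normal_density (c * \<sigma>\<^sup>2) \<sigma> x) \<partial>lborel)"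
    by (subst nn_integral_gaussian) (auto simp: ennreal_mult[symmetric])
  also have "\<dots> = ennreal (exp (c\<^sup>2 * \<sigma>\<^sup>2 / 2))"
    using s by (subst nn_integral_cmult) (auto simp: nn_integral_normal_density)
  finally show ?thesis .
qed

lemma nn_integral_gaussian_exp_square:
  assumes s: "\<sigma> > 0" and t: "t < 1"
  shows "(\<integral>\<^sup>+x. ennreal (exp (t * x\<^sup>2 / (2 * \<sigma>\<^sup>2))) \<partial>gaussian \<sigma>) = ennreal (exp (- ln (1 - t) / 2))"
proof -
  define \<tau> where "\<tau> = \<sigma> / sqrt (1 - t)"
  have \<tau>: "\<tau> > 0" "\<tau>\<^sup>2 = \<sigma>\<^sup>2 / (1 - t)"
    using s t by (auto simp: \<tau>_def power_divide)
  have e: "exp (- ln (1 - t) / 2) = 1 / sqrt (1 - t)"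
    using t by (simp add: exp_minus ln_sqrt[symmetric] inverse_eq_divide)
  have "normal_density 0 \<sigma> x * exp (t * x\<^sup>2 / (2 * \<sigma>\<^sup>2)) = exp (- ln (1 - t) / 2) * normal_density 0 \<tau> x" for x
  proof -
    have 1: "- (x - 0)\<^sup>2 / (2 * \<sigma>\<^sup>2) + t * x\<^sup>2 / (2 * \<sigma>\<^sup>2) = - (x - 0)\<^sup>2 / (2 * \<tau>\<^sup>2)"
      unfolding \<tau> using s t by (simp add: field_simps power2_eq_square)
    have 2: "1 / sqrt (2 * pi * \<sigma>\<^sup>2) = (1 / sqrt (1 - t)) * (1 / sqrt (2 * pi * \<tau>\<^sup>2))"
      unfolding \<tau> using s t by (simp add: real_sqrt_mult real_sqrt_divide)
    have "normal_density 0 \<sigma> x * exp (t * x\<^sup>2 / (2 * \<sigma>\<^sup>2)) = 1 / sqrt (2 * pi * \<sigma>\<^sup>2) * exp (- (x - 0)\<^sup>2 / (2 * \<sigma>\<^sup>2) + t * x\<^sup>2 / (2 * \<sigma>\<^sup>2))"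
      unfolding normal_density_def exp_add by simp
    then show ?thesis
      unfolding 1 2 e unfolding normal_density_def by simp
  qed
  then have "(\<integral>\<^sup>+x. ennreal (exp (t * x\<^sup>2 / (2 * \<sigma>\<^sup>2))) \<partial>gaussian \<sigma>) =
     (\<integral>\<^sup>+x. ennreal (exp (- ln (1 - t) / 2)) * ennreal (normal_density 0 \<tau> x) \<partial>lborel)"
    by (subst nn_integral_gaussian) (auto simp: ennreal_mult[symmetric])
  also have "\<dots> = ennreal (exp (- ln (1 - t) / 2))"
    using \<tau> by (subst nn_integral_cmult) (auto simp: nn_integral_normal_density)
  finally show ?thesis .
qed

text \<open>Up to its constant the integrand is a normal density in \<open>a - x\<close>, so the
  integral is a convolution of two centred normal densities and the variances add.\<close>

lemma nn_integral_gaussian_exp_distance: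
  assumes s: "\<sigma> > 0" and t: "\<tau> > 0"
  shows "(\<integral>\<^sup>+x. ennreal (exp (- (a - x)\<^sup>2 / (2 * \<tau>\<^sup>2))) \<partial>gaussian \<sigma>)
     = ennreal (exp (- ln (1 + \<sigma>\<^sup>2 / \<tau>\<^sup>2) / 2 - a\<^sup>2 / (2 * (\<tau>\<^sup>2 + \<sigma>\<^sup>2))))"
proof -
  have e: "exp (- ln (1 + \<sigma>\<^sup>2 / \<tau>\<^sup>2) / 2) = 1 / sqrt (1 + \<sigma>\<^sup>2 / \<tau>\<^sup>2)"
    using s t by (simp add: exp_minus ln_sqrt[symmetric] inverse_eq_divide add_pos_pos)
  have "(\<integral>\<^sup>+x. ennreal (exp (- (a - x)\<^sup>2 / (2 * \<tau>\<^sup>2))) \<partial>gaussian \<sigma>)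
     = (\<integral>\<^sup>+x. ennreal (sqrt (2 * pi * \<tau>\<^sup>2)) * ennreal (normal_density 0 \<tau> (a - x) * normal_density 0 \<sigma> x) \<partial>lborel)"
    using t by (subst nn_integral_gaussian)
      (auto simp: ennreal_mult[symmetric] normal_density_def intro!: nn_integral_cong)
  also have "\<dots> = ennreal (sqrt (2 * pi * \<tau>\<^sup>2)) * ennreal (normal_density 0 (sqrt (\<tau>\<^sup>2 + \<sigma>\<^sup>2)) a)"
    by (subst nn_integral_cmult) (auto simp: fun_cong[OF conv_normal_density_zero_mean[OF t s]])
  also have "\<dots> = ennreal (sqrt (2 * pi * \<tau>\<^sup>2) * (1 / sqrt (2 * pi * (\<tau>\<^sup>2 + \<sigma>\<^sup>2))) * exp (- a\<^sup>2 / (2 * (\<tau>\<^sup>2 + \<sigma>\<^sup>2))))"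
    by (simp add: ennreal_mult[symmetric] normal_density_def)
  also have "sqrt (2 * pi * \<tau>\<^sup>2) * (1 / sqrt (2 * pi * (\<tau>\<^sup>2 + \<sigma>\<^sup>2))) = sqrt (\<tau>\<^sup>2 / (\<tau>\<^sup>2 + \<sigma>\<^sup>2))"
    by (simp add: real_sqrt_mult real_sqrt_divide)
  also have "\<tau>\<^sup>2 / (\<tau>\<^sup>2 + \<sigma>\<^sup>2) = 1 / (1 + \<sigma>\<^sup>2 / \<tau>\<^sup>2)"
    using t by (simp add: field_simps)
  also have "sqrt (1 / (1 + \<sigma>\<^sup>2 / \<tau>\<^sup>2)) * exp (- a\<^sup>2 / (2 * (\<tau>\<^sup>2 + \<sigma>\<^sup>2)))
     = exp (- ln (1 + \<sigma>\<^sup>2 / \<tau>\<^sup>2) / 2 - a\<^sup>2 / (2 * (\<tau>\<^sup>2 + \<sigma>\<^sup>2)))"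
    using e by (simp add: exp_diff exp_minus real_sqrt_divide inverse_eq_divide)
  finally show ?thesis .
qed

lemma nn_integral_PiM_gaussian_exp_sum:
  assumes "finite I" "\<And>i. i \<in> I \<Longrightarrow> \<sigma> i > 0" "\<And>i. i \<in> I \<Longrightarrow> f i \<in> borel_measurable borel"
    "\<And>i. i \<in> I \<Longrightarrow> (\<integral>\<^sup>+x. ennreal (exp (f i x)) \<partial>gaussian (\<sigma> i)) = ennreal (exp (b i))"
  shows "(\<integral>\<^sup>+u. ennreal (exp (\<Sum>i\<in>I. f i (u i))) \<partial>Pi\<^sub>M I (\<lambda>i. gaussian (\<sigma> i))) = ennreal (exp (\<Sum>i\<in>I. b i))"
proof -
  \<comment> \<open>\<open>product_prob_space\<close> asks for a probability measure at every index,
    also outside \<open>I\<close>.\<close>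
  define \<sigma>' where "\<sigma>' i = (if i \<in> I then \<sigma> i else 1)" for i
  have "prob_space (gaussian (\<sigma>' i))" for i
    using assms(2) by (auto simp: \<sigma>'_def intro!: prob_space_gaussian)
  then interpret product_prob_space "\<lambda>i. gaussian (\<sigma>' i)" I
    by (intro product_prob_spaceI)
  have [measurable]: "\<And>i. i \<in> I \<Longrightarrow> f i \<in> borel_measurable borel" by fact
  have "Pi\<^sub>M I (\<lambda>i. gaussian (\<sigma> i)) = Pi\<^sub>M I (\<lambda>i. gaussian (\<sigma>' i))"
    by (intro PiM_cong) (auto simp: \<sigma>'_def)
  then have "(\<integral>\<^sup>+u. ennreal (exp (\<Sum>i\<in>I. f i (u i))) \<partial>Pi\<^sub>M I (\<lambda>i. gaussian (\<sigma> i)))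
     = (\<integral>\<^sup>+u. (\<Prod>i\<in>I. ennreal (exp (f i (u i)))) \<partial>Pi\<^sub>M I (\<lambda>i. gaussian (\<sigma>' i)))"
    by (simp add: exp_sum[OF assms(1)] prod_ennreal)
  also have "\<dots> = (\<Prod>i\<in>I. \<integral>\<^sup>+x. ennreal (exp (f i x)) \<partial>gaussian (\<sigma>' i))"
    by (rule product_nn_integral_prod) (use assms in auto)
  also have "\<dots> = (\<Prod>i\<in>I. ennreal (exp (b i)))"
    by (intro prod.cong) (auto simp: \<sigma>'_def assms)
  finally show ?thesis
    by (simp add: exp_sum[OF assms(1)] prod_ennreal)
qed

section \<open>Chernoff bounds for the squared norm of a Gaussian vector\<close>

lemma emeasure_le_exp_moment:
  assumes "f \<in> borel_measurable M" "(\<integral>\<^sup>+x. ennreal (exp (f x)) \<partial>M) \<le> ennreal (exp b)"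
  shows "emeasure M {x \<in> space M. f x \<ge> a} \<le> ennreal (exp (b - a))"
proof -
  have "emeasure M {x \<in> space M. f x \<ge> a}
      \<le> (\<integral>\<^sup>+x. ennreal (exp (- a)) * ennreal (exp (f x)) \<partial>M)"
  proof -
    have "emeasure M {x \<in> space M. f x \<ge> a} = (\<integral>\<^sup>+x. indicator {x \<in> space M. f x \<ge> a} x \<partial>M)"
      using assms(1) by (intro nn_integral_indicator[symmetric]) auto
    also have "\<dots> \<le> (\<integral>\<^sup>+x. ennreal (exp (- a)) * ennreal (exp (f x)) \<partial>M)"
    proof (intro nn_integral_mono)
      fix x
      have "1 \<le> exp (- a) * exp (f x)" if "f x \<ge> a"
        using that by (simp add: exp_add[symmetric])
      then show "indicator {x \<in> space M. f x \<ge> a} x \<le> ennreal (exp (- a)) * ennreal (exp (f x))"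
        by (auto simp: indicator_def ennreal_mult[symmetric])
    qed
    finally show ?thesis .
  qed
  also have "\<dots> = ennreal (exp (- a)) * (\<integral>\<^sup>+x. ennreal (exp (f x)) \<partial>M)"
    using assms(1) by (intro nn_integral_cmult) auto
  also have "\<dots> \<le> ennreal (exp (- a)) * ennreal (exp b)"
    by (intro mult_left_mono assms) auto
  finally show ?thesis
    by (simp add: ennreal_mult[symmetric] exp_add[symmetric])
qed

lemma emeasure_gaussian_norm_ge:
  assumes "finite I" "\<sigma> > 0" "\<delta> > 0"
  shows "emeasure (Pi\<^sub>M I (\<lambda>_. gaussian \<sigma>))
      {u \<in> space (Pi\<^sub>M I (\<lambda>_. gaussian \<sigma>)). (\<Sum>i\<in>I. (u i)\<^sup>2) \<ge> real (card I) * \<sigma>\<^sup>2 * (1 + \<delta>)}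
    \<le> ennreal (exp (- (real (card I) * ((\<delta> - ln (1 + \<delta>)) / 2))))"
proof -
  \<comment> \<open>The optimal Chernoff parameter: it minimises the exponent per coordinate,
    \<open>- ln (1 - t) / 2 - t * (1 + \<delta>) / 2\<close>.\<close>
  define t where "t = \<delta> / (1 + \<delta>)"
  have t: "t > 0" "t < 1" "1 - t = inverse (1 + \<delta>)"
    using assms by (auto simp: t_def field_simps)
  let ?M = "Pi\<^sub>M I (\<lambda>_. gaussian \<sigma>)"
  have mgf: "(\<integral>\<^sup>+u. ennreal (exp (\<Sum>i\<in>I. t * (u i)\<^sup>2 / (2 * \<sigma>\<^sup>2))) \<partial>?M)
      = ennreal (exp (\<Sum>i\<in>I. - ln (1 - t) / 2))"
    by (rule nn_integral_PiM_gaussian_exp_sum) (use assms \<open>t < 1\<close> in \<open>auto simp: nn_integral_gaussian_exp_square\<close>)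
  have "emeasure ?M {u \<in> space ?M. (\<Sum>i\<in>I. t * (u i)\<^sup>2 / (2 * \<sigma>\<^sup>2)) \<ge> real (card I) * \<delta> / 2}
     \<le> ennreal (exp (real (card I) * (- ln (1 - t) / 2) - real (card I) * \<delta> / 2))"
    by (rule emeasure_le_exp_moment) (use mgf in auto)
  also have "{u \<in> space ?M. (\<Sum>i\<in>I. t * (u i)\<^sup>2 / (2 * \<sigma>\<^sup>2)) \<ge> real (card I) * \<delta> / 2}
     = {u \<in> space ?M. (\<Sum>i\<in>I. (u i)\<^sup>2) \<ge> real (card I) * \<sigma>\<^sup>2 * (1 + \<delta>)}"
  proof -
    define c where "c = t / (2 * \<sigma>\<^sup>2)"
    have c: "c > 0"
      using assms t by (simp add: c_def)
    have 1: "(\<Sum>i\<in>I. t * (u i)\<^sup>2 / (2 * \<sigma>\<^sup>2)) = c * (\<Sum>i\<in>I. (u i)\<^sup>2)" for u :: "'a \<Rightarrow> real"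
      by (simp add: sum_distrib_left c_def)
    have "t * (1 + \<delta>) = \<delta>"
      using assms by (simp add: t_def)
    then have 2: "real (card I) * \<delta> / 2 = c * (real (card I) * \<sigma>\<^sup>2 * (1 + \<delta>))"
      using assms by (simp add: c_def mult_ac)
    show ?thesis
      unfolding 1 2 using c by (simp add: mult.assoc)
  qed
  also have "real (card I) * (- ln (1 - t) / 2) - real (card I) * \<delta> / 2 = - (real (card I) * ((\<delta> - ln (1 + \<delta>)) / 2))"
  proof -
    have "ln (1 - t) = - ln (1 + \<delta>)"
      using assms t by (simp add: ln_inverse)
    then show ?thesis
      by (simp only:) (simp add: field_simps)
  qed
  finally show ?thesis .
qed

lemma emeasure_gaussian_norm_le:
  assumes "finite I" "\<sigma> > 0" "0 < \<delta>" "\<delta> < 1"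
  shows "emeasure (Pi\<^sub>M I (\<lambda>_. gaussian \<sigma>))
      {u \<in> space (Pi\<^sub>M I (\<lambda>_. gaussian \<sigma>)). (\<Sum>i\<in>I. (u i)\<^sup>2) \<le> real (card I) * \<sigma>\<^sup>2 * (1 - \<delta>)}
    \<le> ennreal (exp (- (real (card I) * ((- \<delta> - ln (1 - \<delta>)) / 2))))"
proof -
  \<comment> \<open>The optimal parameter again, with \<open>- \<delta>\<close> for
    \<open>\<delta>\<close>. Its negative sign turns the lower tail of the norm into an upper tail
    of the exponent.\<close>
  define t where "t = - (\<delta> / (1 - \<delta>))"
  have t: "t < 0" "t < 1" "1 - t = inverse (1 - \<delta>)"
    using assms by (auto simp: t_def field_simps)
  let ?M = "Pi\<^sub>M I (\<lambda>_. gaussian \<sigma>)"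
  have mgf: "(\<integral>\<^sup>+u. ennreal (exp (\<Sum>i\<in>I. t * (u i)\<^sup>2 / (2 * \<sigma>\<^sup>2))) \<partial>?M)
      = ennreal (exp (\<Sum>i\<in>I. - ln (1 - t) / 2))"
    by (rule nn_integral_PiM_gaussian_exp_sum) (use assms \<open>t < 1\<close> in \<open>auto simp: nn_integral_gaussian_exp_square\<close>)
  have "emeasure ?M {u \<in> space ?M. (\<Sum>i\<in>I. t * (u i)\<^sup>2 / (2 * \<sigma>\<^sup>2)) \<ge> - (real (card I) * \<delta> / 2)}
     \<le> ennreal (exp (real (card I) * (- ln (1 - t) / 2) - - (real (card I) * \<delta> / 2)))"
    by (rule emeasure_le_exp_moment) (use mgf in auto)
  also have "{u \<in> space ?M. (\<Sum>i\<in>I. t * (u i)\<^sup>2 / (2 * \<sigma>\<^sup>2)) \<ge> - (real (card I) * \<delta> / 2)}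
     = {u \<in> space ?M. (\<Sum>i\<in>I. (u i)\<^sup>2) \<le> real (card I) * \<sigma>\<^sup>2 * (1 - \<delta>)}"
  proof -
    define c where "c = - t / (2 * \<sigma>\<^sup>2)"
    have c: "c > 0"
      using assms t unfolding c_def by (intro divide_pos_pos) auto
    have 1: "(\<Sum>i\<in>I. t * (u i)\<^sup>2 / (2 * \<sigma>\<^sup>2)) = - (c * (\<Sum>i\<in>I. (u i)\<^sup>2))" for u :: "'a \<Rightarrow> real"
      by (simp add: sum_distrib_left c_def sum_negf)
    have 2: "real (card I) * \<delta> / 2 = c * (real (card I) * \<sigma>\<^sup>2 * (1 - \<delta>))"
      using assms by (simp add: c_def t_def field_simps)
    show ?thesis
      unfolding 1 2 using c by (simp add: mult.assoc)
  qed
  also have "real (card I) * (- ln (1 - t) / 2) - - (real (card I) * \<delta> / 2) = - (real (card I) * ((- \<delta> - ln (1 - \<delta>)) / 2))"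
  proof -
    have "ln (1 - t) = - ln (1 - \<delta>)"
      using assms t by (simp add: ln_inverse)
    then show ?thesis
      by (simp only:) (simp add: field_simps)
  qed
  finally show ?thesis .
qed

section \<open>Linear combinations of Gaussian columns\<close>

text \<open>The joint law of the coordinates is the product measure itself, and the marginals are
  the factors, so the product criterion for independence applies.\<close>

lemma indep_vars_PiM_coordinates:
  assumes "\<And>j. j \<in> J \<Longrightarrow> prob_space (M j)" "J \<noteq> {}"
  shows "prob_space.indep_vars (Pi\<^sub>M J M) M (\<lambda>j \<omega>. \<omega> j) J"
proof -
  interpret prob_space "Pi\<^sub>M J M"
    by (intro prob_space_PiM assms)
  have "distr (Pi\<^sub>M J M) (Pi\<^sub>M J M) (\<lambda>\<omega>. \<lambda>j\<in>J. \<omega> j) = distr (Pi\<^sub>M J M) (Pi\<^sub>M J M) (\<lambda>\<omega>. \<omega>)"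
    by (intro distr_cong) (auto simp: space_PiM PiE_restrict)
  moreover have "Pi\<^sub>M J (\<lambda>j. distr (Pi\<^sub>M J M) (M j) (\<lambda>\<omega>. \<omega> j)) = Pi\<^sub>M J M"
    by (intro PiM_cong) (auto simp: distr_PiM_component assms)
  ultimately show ?thesis
    using assms(2) by (subst indep_vars_iff_distr_eq_PiM') auto
qed

lemma distr_PiM_gaussian_linear_form:
  assumes \<sigma>: "\<And>j. \<sigma> j > 0" and L: "L \<subseteq> J" "finite L"
    and v: "(\<Sum>j\<in>L. (c j)\<^sup>2 * (\<sigma> j)\<^sup>2) > 0"
  shows "distr (Pi\<^sub>M J (\<lambda>j. gaussian (\<sigma> j))) borel (\<lambda>\<omega>. \<Sum>j\<in>L. c j * \<omega> j)
    = gaussian (sqrt (\<Sum>j\<in>L. (c j)\<^sup>2 * (\<sigma> j)\<^sup>2))"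
proof -
  let ?M = "\<lambda>j. gaussian (\<sigma> j)"
  \<comment> \<open>\<open>sum_indep_normal\<close> needs positive standard deviations, so vanishing
    coefficients are removed first.\<close>
  define L' where "L' = {j \<in> L. c j \<noteq> 0}"
  have ps: "prob_space (?M j)" for j
    by (intro prob_space_gaussian \<sigma>)
  interpret prob_space "Pi\<^sub>M J ?M"
    by (intro prob_space_PiM ps)
  have L': "finite L'" "L' \<subseteq> J"
    using L by (auto simp: L'_def)
  have sums: "(\<Sum>j\<in>L. c j * \<omega> j) = (\<Sum>j\<in>L'. c j * \<omega> j)" for \<omega>
    unfolding L'_def using L by (intro sum.mono_neutral_right) auto
  have var: "(\<Sum>j\<in>L. (c j)\<^sup>2 * (\<sigma> j)\<^sup>2) = (\<Sum>j\<in>L'. (\<bar>c j\<bar> * \<sigma> j)\<^sup>2)"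
    unfolding L'_def using L by (simp add: power_mult_distrib) (intro sum.mono_neutral_right, auto)
  have ne: "L' \<noteq> {}"
    using v unfolding var by auto
  with L' have "J \<noteq> {}" by auto
  then have "indep_vars ?M (\<lambda>j \<omega>. \<omega> j) J"
    by (intro indep_vars_PiM_coordinates ps)
  then have "indep_vars ?M (\<lambda>j \<omega>. \<omega> j) L'"
    using L'(2) by (rule indep_vars_subset)
  then have ind: "indep_vars (\<lambda>_. borel) (\<lambda>j \<omega>. c j * \<omega> j) L'"
    by (rule indep_vars_compose2) auto
  have "distributed (Pi\<^sub>M J ?M) lborel (\<lambda>\<omega>. \<Sum>j\<in>L'. c j * \<omega> j)
      (normal_density (\<Sum>j\<in>L'. 0 + c j * 0) (sqrt (\<Sum>j\<in>L'. (\<bar>c j\<bar> * \<sigma> j)\<^sup>2)))"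
  proof (intro sum_indep_normal L' ne ind)
    fix j assume j: "j \<in> L'"
    then have jJ: "j \<in> J" and cj: "c j \<noteq> 0"
      using L' by (auto simp: L'_def)
    show "0 < \<bar>c j\<bar> * \<sigma> j"
      using cj \<sigma> by auto
    have "distr (Pi\<^sub>M J ?M) lborel (\<lambda>\<omega>. \<omega> j) = distr (Pi\<^sub>M J ?M) (?M j) (\<lambda>\<omega>. \<omega> j)"
      by (intro distr_cong) auto
    also have "\<dots> = ?M j"
      using jJ by (intro distr_PiM_component ps)
    finally have "distributed (Pi\<^sub>M J ?M) lborel (\<lambda>\<omega>. \<omega> j) (normal_density 0 (\<sigma> j))"
      using jJ by (auto simp: distributed_def gaussian_def intro!: measurable_compose[OF measurable_component_singleton[OF jJ]])
    from normal_density_affine[OF this \<sigma> cj, of 0]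
    show "distributed (Pi\<^sub>M J ?M) lborel (\<lambda>\<omega>. c j * \<omega> j) (normal_density (0 + c j * 0) (\<bar>c j\<bar> * \<sigma> j))"
      by simp
  qed
  then have "distr (Pi\<^sub>M J ?M) lborel (\<lambda>\<omega>. \<Sum>j\<in>L'. c j * \<omega> j) = gaussian (sqrt (\<Sum>j\<in>L'. (\<bar>c j\<bar> * \<sigma> j)\<^sup>2))"
    by (simp add: distributed_def gaussian_def)
  moreover have "distr (Pi\<^sub>M J ?M) borel (\<lambda>\<omega>. \<Sum>j\<in>L'. c j * \<omega> j) = distr (Pi\<^sub>M J ?M) lborel (\<lambda>\<omega>. \<Sum>j\<in>L'. c j * \<omega> j)"
    by (intro distr_cong) auto
  ultimately show ?thesis
    unfolding var sums by simp
qed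

lemma measurable_column_combination:
  assumes "K \<subseteq> C"
  shows "(\<lambda>\<omega>. \<lambda>i\<in>I. \<Sum>s\<in>K. c s * \<omega> (i, s)) \<in> Pi\<^sub>M (I \<times> C) (\<lambda>j. gaussian (\<sigma> (snd j))) \<rightarrow>\<^sub>M Pi\<^sub>M I (\<lambda>_. borel)"
proof (intro measurable_restrict borel_measurable_sum borel_measurable_times)
  fix i s assume "i \<in> I" "s \<in> K"
  then have "(i, s) \<in> I \<times> C" using assms by auto
  from measurable_component_singleton[OF this, of "\<lambda>j. gaussian (\<sigma> (snd j))"]
  show "(\<lambda>\<omega>. \<omega> (i, s)) \<in> borel_measurable (Pi\<^sub>M (I \<times> C) (\<lambda>j. gaussian (\<sigma> (snd j))))"
    by (simp cong: measurable_cong_sets)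
qed auto

text \<open>Different rows use disjoint blocks of coordinates and are therefore independent. Since
  \<open>\<sigma>\<close> depends on the column only, all rows have the same variance.\<close>

lemma distr_PiM_gaussian_column_combination:
  fixes I :: "'i set" and C :: "'s set" and \<sigma> c :: "'s \<Rightarrow> real"
  assumes \<sigma>: "\<And>s. \<sigma> s > 0" and C: "finite C" "I \<noteq> {}"
    and v: "(\<Sum>s\<in>C. (c s)\<^sup>2 * (\<sigma> s)\<^sup>2) > 0"
  shows "distr (Pi\<^sub>M (I \<times> C) (\<lambda>j. gaussian (\<sigma> (snd j)))) (Pi\<^sub>M I (\<lambda>_. borel)) (\<lambda>\<omega>. \<lambda>i\<in>I. \<Sum>s\<in>C. c s * \<omega> (i, s))
    = Pi\<^sub>M I (\<lambda>_. gaussian (sqrt (\<Sum>s\<in>C. (c s)\<^sup>2 * (\<sigma> s)\<^sup>2)))"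
proof -
  let ?M = "\<lambda>j. gaussian (\<sigma> (snd j))"
  let ?f = "\<lambda>i \<omega>. \<Sum>s\<in>C. c s * \<omega> (i, s)"
  have ps: "prob_space (?M j)" for j
    by (intro prob_space_gaussian \<sigma>)
  interpret prob_space "Pi\<^sub>M (I \<times> C) ?M"
    by (intro prob_space_PiM ps)
  have "C \<noteq> {}" using v by auto
  then have ne: "I \<times> C \<noteq> {}" using C by auto
  have "indep_vars (\<lambda>i. Pi\<^sub>M ({i} \<times> C) ?M) (\<lambda>i \<omega>. restrict (\<lambda>j. \<omega> j) ({i} \<times> C)) I"
    by (rule indep_vars_restrict[OF indep_vars_PiM_coordinates[OF ps ne]])
      (auto simp: disjoint_family_on_def)
  then have "indep_vars (\<lambda>_. borel) (\<lambda>i \<omega>. ?f i (restrict (\<lambda>j. \<omega> j) ({i} \<times> C))) I"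
  proof (rule indep_vars_compose2)
    fix i assume "i \<in> I"
    have "(\<lambda>\<omega>. \<omega> (i, s)) \<in> borel_measurable (Pi\<^sub>M ({i} \<times> C) ?M)" if "s \<in> C" for s
      using measurable_component_singleton[of "(i, s)" "{i} \<times> C" ?M] that by (simp cong: measurable_cong_sets)
    then show "?f i \<in> borel_measurable (Pi\<^sub>M ({i} \<times> C) ?M)"
      by (intro borel_measurable_sum borel_measurable_times) auto
  qed
  then have ind: "indep_vars (\<lambda>_. borel) ?f I"
    by (rule indep_vars_cong[THEN iffD1, rotated -1]) auto
  have comp: "distr (Pi\<^sub>M (I \<times> C) ?M) borel (?f i) = gaussian (sqrt (\<Sum>s\<in>C. (c s)\<^sup>2 * (\<sigma> s)\<^sup>2))" if "i \<in> I" for i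
  proof -
    have *: "(\<Sum>j\<in>{i} \<times> C. h j) = (\<Sum>s\<in>C. h (i, s))" for h :: "'i \<times> 's \<Rightarrow> real"
      by (simp add: sum.cartesian_product')
    show ?thesis
      using distr_PiM_gaussian_linear_form[of "\<lambda>j. \<sigma> (snd j)" "{i} \<times> C" "I \<times> C" "\<lambda>j. c (snd j)"]
      using \<sigma> C v that unfolding * by auto
  qed
  have "distr (Pi\<^sub>M (I \<times> C) ?M) (Pi\<^sub>M I (\<lambda>_. borel)) (\<lambda>\<omega>. \<lambda>i\<in>I. ?f i \<omega>)
     = Pi\<^sub>M I (\<lambda>i. distr (Pi\<^sub>M (I \<times> C) ?M) borel (?f i))"
    using ind C by (subst (asm) indep_vars_iff_distr_eq_PiM') (auto simp: indep_vars_def)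
  also have "\<dots> = Pi\<^sub>M I (\<lambda>_. gaussian (sqrt (\<Sum>s\<in>C. (c s)\<^sup>2 * (\<sigma> s)\<^sup>2)))"
    by (intro PiM_cong comp) auto
  finally show ?thesis .
qed

lemma emeasure_condition_on_columns:
  fixes Q :: "('i \<times> 's \<Rightarrow> real) \<Rightarrow> ('i \<Rightarrow> real) \<Rightarrow> bool" and \<sigma> c :: "'s \<Rightarrow> real"
    and I :: "'i set" and C K :: "'s set"
  defines "N \<equiv> Pi\<^sub>M (I \<times> C) (\<lambda>j. gaussian (\<sigma> (snd j)))"
  defines "E \<equiv> {\<omega> \<in> space N. Q (restrict \<omega> (I \<times> (C - K))) (\<lambda>i\<in>I. \<Sum>s\<in>K. c s * \<omega> (i, s))}"
  assumes \<sigma>: "\<And>s. \<sigma> s > 0" and fin: "finite I" "I \<noteq> {}" "finite C" "K \<subseteq> C"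
    and v: "(\<Sum>s\<in>K. (c s)\<^sup>2 * (\<sigma> s)\<^sup>2) > 0"
    and E: "E \<in> sets N"
    and meas: "\<And>x. {u \<in> space (Pi\<^sub>M I (\<lambda>_. borel)). Q x u} \<in> sets (Pi\<^sub>M I (\<lambda>_. borel))"
    and bound: "\<And>x. emeasure (Pi\<^sub>M I (\<lambda>_. gaussian (sqrt (\<Sum>s\<in>K. (c s)\<^sup>2 * (\<sigma> s)\<^sup>2))))
        {u \<in> space (Pi\<^sub>M I (\<lambda>_. borel)). Q x u} \<le> b"
  shows "emeasure N E \<le> b"
proof -
  let ?M = "\<lambda>j. gaussian (\<sigma> (snd j))"
  let ?f = "\<lambda>\<omega>. \<lambda>i\<in>I. \<Sum>s\<in>K. c s * \<omega> (i, s)"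
  define J L where "J = I \<times> (C - K)" and "L = I \<times> K"
  have JL: "J \<inter> L = {}" "finite J" "finite L" "J \<union> L = I \<times> C"
    using fin by (auto simp: J_def L_def finite_subset)
  have ps: "prob_space (?M j)" for j
    by (intro prob_space_gaussian \<sigma>)
  interpret product_prob_space ?M "I \<times> C"
    by (intro product_prob_spaceI ps)
  interpret J: prob_space "Pi\<^sub>M J ?M"
    by (intro prob_space_PiM ps)
  have K: "finite K"
    using fin finite_subset by auto
  have f: "?f \<in> Pi\<^sub>M L ?M \<rightarrow>\<^sub>M Pi\<^sub>M I (\<lambda>_. borel)"
    unfolding L_def by (rule measurable_column_combination) auto
  have "emeasure N E = (\<integral>\<^sup>+\<omega>. indicator E \<omega> \<partial>Pi\<^sub>M (J \<union> L) ?M)"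
    using E JL by (simp add: N_def)
  also have "\<dots> = (\<integral>\<^sup>+x. (\<integral>\<^sup>+y. indicator E (merge J L (x, y)) \<partial>Pi\<^sub>M L ?M) \<partial>Pi\<^sub>M J ?M)"
    using E JL by (intro product_nn_integral_fold) (auto simp: N_def)
  also have "\<dots> \<le> (\<integral>\<^sup>+x. b \<partial>Pi\<^sub>M J ?M)"
  proof (intro nn_integral_mono)
    fix x assume x: "x \<in> space (Pi\<^sub>M J ?M)"
    let ?U = "{u \<in> space (Pi\<^sub>M I (\<lambda>_. borel)). Q x u}"
    \<comment> \<open>With the columns outside \<open>K\<close> frozen at \<open>x\<close>, the
      section of \<open>E\<close> is a preimage under the column combination.\<close>
    have "indicator E (merge J L (x, y)) = indicator (?f -` ?U \<inter> space (Pi\<^sub>M L ?M)) y"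
      if y: "y \<in> space (Pi\<^sub>M L ?M)" for y
    proof -
      have "merge J L (x, y) \<in> space N"
        using x y JL unfolding N_def by (auto simp: space_PiM PiE_def Pi_iff merge_def extensional_def)
      moreover have "restrict (merge J L (x, y)) (I \<times> (C - K)) = x"
        using x JL by (auto simp: J_def[symmetric] space_PiM PiE_def extensional_restrict)
      moreover have "?f (merge J L (x, y)) = ?f y"
        using JL(1) by (auto simp: fun_eq_iff merge_def J_def L_def intro!: sum.cong)
      moreover have "?f y \<in> space (Pi\<^sub>M I (\<lambda>_. borel))"
        by (simp add: space_PiM)
      ultimately show ?thesis
        using y by (auto simp: E_def indicator_def)
    qed
    then have "(\<integral>\<^sup>+y. indicator E (merge J L (x, y)) \<partial>Pi\<^sub>M L ?M)
        = (\<integral>\<^sup>+y. indicator (?f -` ?U \<inter> space (Pi\<^sub>M L ?M)) y \<partial>Pi\<^sub>M L ?M)"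
      by (rule nn_integral_cong)
    also have "\<dots> = emeasure (distr (Pi\<^sub>M L ?M) (Pi\<^sub>M I (\<lambda>_. borel)) ?f) ?U"
      using meas f by (subst emeasure_distr) (auto intro: measurable_sets)
    also have "distr (Pi\<^sub>M L ?M) (Pi\<^sub>M I (\<lambda>_. borel)) ?f = Pi\<^sub>M I (\<lambda>_. gaussian (sqrt (\<Sum>s\<in>K. (c s)\<^sup>2 * (\<sigma> s)\<^sup>2)))"
      unfolding L_def by (intro distr_PiM_gaussian_column_combination \<sigma> K fin v)
    finally show "(\<integral>\<^sup>+y. indicator E (merge J L (x, y)) \<partial>Pi\<^sub>M L ?M) \<le> b"
      using bound[of x] by simp
  qed
  also have "\<dots> = b"
    by (simp add: J.emeasure_space_1)
  finally show ?thesis .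
qed

section \<open>Distance of a Gaussian vector from a subspace\<close>

text \<open>Gram-Schmidt, one vector per induction step. Since zero vectors are allowed, the system
  keeps the index set \<open>R\<close> even if the vectors \<open>a s\<close> are dependent, and
  \<open>card R\<close> can replace the dimension of their span.\<close>

lemma orthogonal_system_exists:
  fixes a :: "'s \<Rightarrow> 'i \<Rightarrow> real"
  assumes "finite I" "finite R"
  shows "\<exists>e. (\<forall>s\<in>R. \<forall>t\<in>R. s \<noteq> t \<longrightarrow> (\<Sum>i\<in>I. e s i * e t i) = 0)
     \<and> (\<forall>s\<in>R. (\<Sum>i\<in>I. (e s i)\<^sup>2) = 1 \<or> (\<forall>i\<in>I. e s i = 0))
     \<and> (\<forall>s\<in>R. \<exists>\<beta>. \<forall>i\<in>I. a s i = (\<Sum>t\<in>R. \<beta> t * e t i))"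
  using assms(2)
proof (induction R rule: finite_induct)
  case empty
  then show ?case by auto
next
  case (insert r R)
  then obtain e where e: "\<forall>s\<in>R. \<forall>t\<in>R. s \<noteq> t \<longrightarrow> (\<Sum>i\<in>I. e s i * e t i) = 0"
      "\<forall>s\<in>R. (\<Sum>i\<in>I. (e s i)\<^sup>2) = 1 \<or> (\<forall>i\<in>I. e s i = 0)"
      "\<forall>s\<in>R. \<exists>\<beta>. \<forall>i\<in>I. a s i = (\<Sum>t\<in>R. \<beta> t * e t i)"
    by (elim exE conjE)
  note orth = e(1)[rule_format] and unit = e(2)[THEN bspec] and span = e(3)[THEN bspec]
  define p where "p t = (\<Sum>i\<in>I. a r i * e t i)" for t
  define f where "f i = a r i - (\<Sum>t\<in>R. p t * e t i)" for i
  define q where "q = sqrt (\<Sum>i\<in>I. (f i)\<^sup>2)"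
  have fe: "(\<Sum>i\<in>I. f i * e s i) = 0" if s: "s \<in> R" for s
  proof -
    have "(\<Sum>i\<in>I. f i * e s i) = p s - (\<Sum>t\<in>R. p t * (\<Sum>i\<in>I. e t i * e s i))"
      by (simp add: f_def p_def left_diff_distrib sum_subtractf sum_distrib_right sum_distrib_left mult.assoc)
        (rule sum.swap)
    also have "(\<Sum>t\<in>R. p t * (\<Sum>i\<in>I. e t i * e s i)) = (\<Sum>t\<in>R. if t = s then p s * (\<Sum>i\<in>I. (e s i)\<^sup>2) else 0)"
      by (intro sum.cong refl) (auto simp: orth s power2_eq_square)
    also have "\<dots> = p s * (\<Sum>i\<in>I. (e s i)\<^sup>2)"
      using insert.hyps s by simp
    \<comment> \<open>If \<open>e s\<close> vanishes on \<open>I\<close>, then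
      \<open>p s = 0\<close> and both sides are 0.\<close>
    also have "\<dots> = p s"
      using unit[OF s] by (auto simp: p_def)
    finally show ?thesis by simp
  qed
  have f0: "f i = 0" if "q = 0" "i \<in> I" for i
    using that assms(1) by (simp add: q_def sum_nonneg_eq_0_iff)
  have q2: "(\<Sum>i\<in>I. (f i)\<^sup>2) = q\<^sup>2"
    by (simp add: q_def sum_nonneg)
  \<comment> \<open>If \<open>q = 0\<close> then \<open>f i / q = 0\<close>, so a dependent vector contributes the zero vector.\<close>
  define e' where "e' = e(r := \<lambda>i. f i / q)"
  have e': "e' s = e s" if "s \<in> R" for s
    using that insert.hyps by (auto simp: e'_def)
  have orth': "(\<Sum>i\<in>I. e' s i * e' t i) = 0" if "s \<in> insert r R" "t \<in> insert r R" "s \<noteq> t" for s t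
  proof -
    have 1: "(\<Sum>i\<in>I. e' r i * e' t i) = 0" if "t \<in> R" for t
      using fe[OF that] by (simp add: e'[OF that]) (simp add: e'_def sum_divide_distrib[symmetric])
    show ?thesis
      using that 1 orth[of s t] by (auto simp: e' mult.commute)
  qed
  have unit': "(\<Sum>i\<in>I. (e' s i)\<^sup>2) = 1 \<or> (\<forall>i\<in>I. e' s i = 0)" if "s \<in> insert r R" for s
  proof (cases "s = r")
    case True
    then show ?thesis
      using q2 by (cases "q = 0") (auto simp: e'_def power_divide sum_divide_distrib[symmetric])
  next
    case False
    then show ?thesis
      using that unit[of s] by (auto simp: e')
  qed
  have span': "\<exists>\<beta>. \<forall>i\<in>I. a s i = (\<Sum>t\<in>insert r R. \<beta> t * e' t i)" if "s \<in> insert r R" for s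
  proof (cases "s = r")
    case True
    have "a r i = (\<Sum>t\<in>insert r R. (p(r := q)) t * e' t i)" if "i \<in> I" for i
    proof -
      have "(\<Sum>t\<in>insert r R. (p(r := q)) t * e' t i) = q * (f i / q) + (\<Sum>t\<in>R. p t * e t i)"
      proof -
        have "(\<Sum>t\<in>R. (p(r := q)) t * e' t i) = (\<Sum>t\<in>R. p t * e t i)"
          using insert.hyps by (intro sum.cong) (auto simp: e')
        then show ?thesis
          using insert.hyps by (simp add: e'_def)
      qed
      also have "q * (f i / q) = f i"
        using f0 that by auto
      finally show ?thesis by (simp add: f_def)
    qed
    then show ?thesis using True by blast
  next
    case False
    then have "s \<in> R" using that by auto
    from span[OF this] obtain \<beta> where \<beta>: "\<forall>i\<in>I. a s i = (\<Sum>t\<in>R. \<beta> t * e t i)"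
      by (elim exE)
    have "a s i = (\<Sum>t\<in>insert r R. (\<beta>(r := 0)) t * e' t i)" if "i \<in> I" for i
      using \<beta> insert.hyps that by (auto simp: e' intro!: sum.cong)
    then show ?thesis by blast
  qed
  show ?case
    using orth' unit' span' by blast
qed

text \<open>The left side of the last inequality is the squared distance of \<open>u\<close> from
  the span of the \<open>a s\<close>, by Pythagoras. It is free of \<open>D\<close>, so one event in
  \<open>u\<close> handles all coefficient vectors at once.\<close>

lemma norm_add_span_ge:
  fixes a :: "'s \<Rightarrow> 'i \<Rightarrow> real"
  assumes fin: "finite I" "finite R"
  obtains e :: "'s \<Rightarrow> 'i \<Rightarrow> real"
  where "\<And>s t. s \<in> R \<Longrightarrow> t \<in> R \<Longrightarrow> s \<noteq> t \<Longrightarrow> (\<Sum>i\<in>I. e s i * e t i) = 0"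
    and "\<And>s. s \<in> R \<Longrightarrow> (\<Sum>i\<in>I. (e s i)\<^sup>2) \<le> 1"
    and "\<And>u D. (\<Sum>i\<in>I. (u i)\<^sup>2) - (\<Sum>s\<in>R. (\<Sum>i\<in>I. u i * e s i)\<^sup>2) \<le> (\<Sum>i\<in>I. (u i + (\<Sum>s\<in>R. D s * a s i))\<^sup>2)"
proof -
  from orthogonal_system_exists[OF fin, of a]
  obtain e where e: "\<forall>s\<in>R. \<forall>t\<in>R. s \<noteq> t \<longrightarrow> (\<Sum>i\<in>I. e s i * e t i) = 0"
      "\<forall>s\<in>R. (\<Sum>i\<in>I. (e s i)\<^sup>2) = 1 \<or> (\<forall>i\<in>I. e s i = 0)"
      "\<forall>s\<in>R. \<exists>\<beta>. \<forall>i\<in>I. a s i = (\<Sum>t\<in>R. \<beta> t * e t i)"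
    by (elim exE conjE)
  note orth = e(1)[rule_format] and unit = e(2)[THEN bspec]
  from bchoice[OF e(3)] obtain \<beta> where \<beta>: "\<forall>s\<in>R. \<forall>i\<in>I. a s i = (\<Sum>t\<in>R. \<beta> s t * e t i)"
    by (elim exE)
  have "(\<Sum>i\<in>I. (u i)\<^sup>2) - (\<Sum>s\<in>R. (\<Sum>i\<in>I. u i * e s i)\<^sup>2) \<le> (\<Sum>i\<in>I. (u i + (\<Sum>s\<in>R. D s * a s i))\<^sup>2)" for u D
  proof -
    define \<gamma> where "\<gamma> t = (\<Sum>s\<in>R. D s * \<beta> s t)" for t
    define p where "p t = (\<Sum>i\<in>I. u i * e t i)" for t
    define h where "h i = (\<Sum>t\<in>R. \<gamma> t * e t i)" for i
    have h: "(\<Sum>s\<in>R. D s * a s i) = h i" if "i \<in> I" for i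
    proof -
      have "(\<Sum>s\<in>R. D s * a s i) = (\<Sum>s\<in>R. \<Sum>t\<in>R. D s * \<beta> s t * e t i)"
        by (intro sum.cong) (auto simp: \<beta> that sum_distrib_left mult.assoc)
      also have "\<dots> = (\<Sum>t\<in>R. \<Sum>s\<in>R. D s * \<beta> s t * e t i)"
        by (rule sum.swap)
      finally show ?thesis
        by (simp add: h_def \<gamma>_def sum_distrib_right)
    qed
    have uh: "(\<Sum>i\<in>I. u i * h i) = (\<Sum>t\<in>R. \<gamma> t * p t)"
      by (simp add: h_def p_def sum_distrib_left mult_ac) (rule sum.swap)
    have hh: "(\<Sum>i\<in>I. (h i)\<^sup>2) = (\<Sum>t\<in>R. (\<gamma> t)\<^sup>2 * (\<Sum>i\<in>I. (e t i)\<^sup>2))"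
    proof -
      have "(\<Sum>i\<in>I. (h i)\<^sup>2) = (\<Sum>i\<in>I. \<Sum>s\<in>R. \<Sum>t\<in>R. (\<gamma> s * \<gamma> t) * (e s i * e t i))"
        by (simp add: h_def power2_eq_square sum_product mult_ac)
      also have "\<dots> = (\<Sum>s\<in>R. \<Sum>i\<in>I. \<Sum>t\<in>R. (\<gamma> s * \<gamma> t) * (e s i * e t i))"
        by (rule sum.swap)
      also have "\<dots> = (\<Sum>s\<in>R. \<Sum>t\<in>R. \<Sum>i\<in>I. (\<gamma> s * \<gamma> t) * (e s i * e t i))"
        by (intro sum.cong refl sum.swap)
      also have "\<dots> = (\<Sum>s\<in>R. \<Sum>t\<in>R. if t = s then (\<gamma> s)\<^sup>2 * (\<Sum>i\<in>I. (e s i)\<^sup>2) else 0)"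
        by (intro sum.cong refl) (auto simp: sum_distrib_left[symmetric] orth power2_eq_square)
      finally show ?thesis
        using fin by simp
    qed
    have "(\<Sum>i\<in>I. (u i + (\<Sum>s\<in>R. D s * a s i))\<^sup>2) = (\<Sum>i\<in>I. (u i + h i)\<^sup>2)"
      by (intro sum.cong) (auto simp: h)
    also have "\<dots> = (\<Sum>i\<in>I. (u i)\<^sup>2) + (2 * (\<Sum>i\<in>I. u i * h i) + (\<Sum>i\<in>I. (h i)\<^sup>2))"
      by (simp add: power2_sum sum.distrib sum_distrib_left mult_ac)
    also have "2 * (\<Sum>i\<in>I. u i * h i) + (\<Sum>i\<in>I. (h i)\<^sup>2) = (\<Sum>t\<in>R. 2 * (\<gamma> t * p t) + (\<gamma> t)\<^sup>2 * (\<Sum>i\<in>I. (e t i)\<^sup>2))"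
      unfolding uh hh by (simp add: sum.distrib sum_distrib_left)
    finally have eq: "(\<Sum>i\<in>I. (u i + (\<Sum>s\<in>R. D s * a s i))\<^sup>2)
      = (\<Sum>i\<in>I. (u i)\<^sup>2) + (\<Sum>t\<in>R. 2 * (\<gamma> t * p t) + (\<gamma> t)\<^sup>2 * (\<Sum>i\<in>I. (e t i)\<^sup>2))" .
    \<comment> \<open>For a unit vector the difference of the two terms is the square of
      \<open>p t + \<gamma> t\<close>; for a zero vector \<open>p t\<close> vanishes.\<close>
    have "(\<Sum>t\<in>R. - (p t)\<^sup>2) \<le> (\<Sum>t\<in>R. 2 * (\<gamma> t * p t) + (\<gamma> t)\<^sup>2 * (\<Sum>i\<in>I. (e t i)\<^sup>2))"
    proof (intro sum_mono)
      fix t assume "t \<in> R"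
      from unit[OF this] show "- (p t)\<^sup>2 \<le> 2 * (\<gamma> t * p t) + (\<gamma> t)\<^sup>2 * (\<Sum>i\<in>I. (e t i)\<^sup>2)"
      proof
        assume "(\<Sum>i\<in>I. (e t i)\<^sup>2) = 1"
        then show ?thesis
          using zero_le_power2[of "p t + \<gamma> t"] by (simp add: power2_sum mult_ac)
      next
        assume "\<forall>i\<in>I. e t i = 0"
        then have "p t = 0" by (simp add: p_def)
        then show ?thesis by (simp add: sum_nonneg)
      qed
    qed
    then show ?thesis
      unfolding eq p_def[symmetric] by (simp add: sum_negf)
  qed
  moreover have "(\<Sum>i\<in>I. (e s i)\<^sup>2) \<le> 1" if "s \<in> R" for s
    using unit[OF that] by auto
  ultimately show ?thesis
    by (intro that[of e] orth)
qed

text \<open>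
  Each square in the exponent is linearised by an auxiliary Gaussian variable, via
  \<open>exp (p\<^sup>2 / 2) = E (exp (p g))\<close>; no rotation invariance is needed.
\<close>

lemma nn_integral_gaussian_exp_projection:
  fixes e :: "'s \<Rightarrow> 'i \<Rightarrow> real"
  assumes fin: "finite I" "finite R" and s: "\<sigma> > 0"
    and orth: "\<And>s t. s \<in> R \<Longrightarrow> t \<in> R \<Longrightarrow> s \<noteq> t \<Longrightarrow> (\<Sum>i\<in>I. e s i * e t i) = 0"
    and unit: "\<And>s. s \<in> R \<Longrightarrow> (\<Sum>i\<in>I. (e s i)\<^sup>2) \<le> 1"
  shows "(\<integral>\<^sup>+u. ennreal (exp (\<Sum>s\<in>R. (\<Sum>i\<in>I. u i * e s i)\<^sup>2 / (4 * \<sigma>\<^sup>2))) \<partial>Pi\<^sub>M I (\<lambda>_. gaussian \<sigma>))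
    \<le> ennreal (exp (real (card R) * (ln 2 / 2)))"
proof -
  let ?U = "Pi\<^sub>M I (\<lambda>_. gaussian \<sigma>)" and ?G = "Pi\<^sub>M R (\<lambda>_. gaussian 1)"
  define p where "p s u = (\<Sum>i\<in>I. u i * e s i)" for s and u :: "'i \<Rightarrow> real"
  \<comment> \<open>Chosen so that averaging \<open>exp (c * p * g)\<close> over a standard Gaussian
    \<open>g\<close> gives \<open>exp (p\<^sup>2 / (4 * \<sigma>\<^sup>2))\<close>.\<close>
  define c where "c = 1 / (sqrt 2 * \<sigma>)"
  have c2: "c\<^sup>2 = 1 / (2 * \<sigma>\<^sup>2)"
    by (simp add: c_def power_divide power_mult_distrib)
  have U: "prob_space ?U" and G: "prob_space ?G"
    using s by (auto intro!: prob_space_PiM prob_space_gaussian)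
  interpret U: prob_space ?U by fact
  interpret G: prob_space ?G by fact
  interpret UG: pair_prob_space ?U ?G ..
  have "(\<integral>\<^sup>+u. ennreal (exp (\<Sum>s\<in>R. (p s u)\<^sup>2 / (4 * \<sigma>\<^sup>2))) \<partial>?U)
      = (\<integral>\<^sup>+u. (\<integral>\<^sup>+g. ennreal (exp (\<Sum>s\<in>R. c * p s u * g s)) \<partial>?G) \<partial>?U)"
  proof (intro nn_integral_cong)
    fix u
    have "(\<integral>\<^sup>+x. ennreal (exp (c * p s u * x)) \<partial>gaussian 1) = ennreal (exp ((p s u)\<^sup>2 / (4 * \<sigma>\<^sup>2)))" for s
      by (subst nn_integral_gaussian_exp_linear) (simp_all add: power_mult_distrib c2)
    then show "ennreal (exp (\<Sum>s\<in>R. (p s u)\<^sup>2 / (4 * \<sigma>\<^sup>2))) = (\<integral>\<^sup>+g. ennreal (exp (\<Sum>s\<in>R. c * p s u * g s)) \<partial>?G)"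
      by (intro nn_integral_PiM_gaussian_exp_sum[symmetric] fin) auto
  qed
  also have "\<dots> = (\<integral>\<^sup>+g. (\<integral>\<^sup>+u. ennreal (exp (\<Sum>s\<in>R. c * p s u * g s)) \<partial>?U) \<partial>?G)"
    unfolding p_def by (rule UG.Fubini'[symmetric]) measurable
  \<comment> \<open>For fixed \<open>g\<close> the exponent is linear in \<open>u\<close>.
    Integrating \<open>u\<close> out leaves a quarter of the squared norm of the combination of the
    \<open>e s\<close> with weights \<open>g s\<close>, which orthogonality bounds by a quarter of
    the squared norm of \<open>g\<close>. The result is written to match
    \<open>nn_integral_gaussian_exp_square\<close> with \<open>t = 1 / 2\<close>.\<close>
  also have "\<dots> \<le> (\<integral>\<^sup>+g. ennreal (exp (\<Sum>s\<in>R. (1 / 2) * (g s)\<^sup>2 / (2 * 1\<^sup>2))) \<partial>?G)"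
  proof (intro nn_integral_mono)
    fix g :: "'s \<Rightarrow> real"
    define d where "d i = c * (\<Sum>s\<in>R. g s * e s i)" for i
    have "(\<Sum>s\<in>R. c * p s u * g s) = (\<Sum>i\<in>I. d i * u i)" for u
    proof -
      have "(\<Sum>s\<in>R. c * p s u * g s) = (\<Sum>s\<in>R. \<Sum>i\<in>I. c * (g s * e s i) * u i)"
        by (simp add: p_def sum_distrib_left sum_distrib_right mult_ac)
      also have "\<dots> = (\<Sum>i\<in>I. \<Sum>s\<in>R. c * (g s * e s i) * u i)"
        by (rule sum.swap)
      finally show ?thesis
        by (simp add: d_def sum_distrib_left sum_distrib_right)
    qed
    then have "(\<integral>\<^sup>+u. ennreal (exp (\<Sum>s\<in>R. c * p s u * g s)) \<partial>?U) = (\<integral>\<^sup>+u. ennreal (exp (\<Sum>i\<in>I. d i * u i)) \<partial>?U)"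
      by simp
    also have "\<dots> = ennreal (exp (\<Sum>i\<in>I. (d i)\<^sup>2 * \<sigma>\<^sup>2 / 2))"
      using s by (intro nn_integral_PiM_gaussian_exp_sum fin nn_integral_gaussian_exp_linear) auto
    also have "(\<Sum>i\<in>I. (d i)\<^sup>2 * \<sigma>\<^sup>2 / 2) \<le> (\<Sum>s\<in>R. (1 / 2) * (g s)\<^sup>2 / (2 * 1\<^sup>2))"
    proof -
      have "(\<Sum>i\<in>I. (\<Sum>s\<in>R. g s * e s i)\<^sup>2) = (\<Sum>i\<in>I. \<Sum>s\<in>R. \<Sum>t\<in>R. (g s * g t) * (e s i * e t i))"
        by (simp add: power2_eq_square sum_product mult_ac)
      also have "\<dots> = (\<Sum>s\<in>R. \<Sum>i\<in>I. \<Sum>t\<in>R. (g s * g t) * (e s i * e t i))"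
        by (rule sum.swap)
      also have "\<dots> = (\<Sum>s\<in>R. \<Sum>t\<in>R. \<Sum>i\<in>I. (g s * g t) * (e s i * e t i))"
        by (intro sum.cong refl sum.swap)
      also have "\<dots> = (\<Sum>s\<in>R. \<Sum>t\<in>R. if t = s then (g s)\<^sup>2 * (\<Sum>i\<in>I. (e s i)\<^sup>2) else 0)"
        by (intro sum.cong refl) (auto simp: sum_distrib_left[symmetric] orth power2_eq_square)
      also have "\<dots> = (\<Sum>s\<in>R. (g s)\<^sup>2 * (\<Sum>i\<in>I. (e s i)\<^sup>2))"
        using fin by simp
      also have "\<dots> \<le> (\<Sum>s\<in>R. (g s)\<^sup>2)"
        by (intro sum_mono mult_left_le unit) auto
      finally have "(\<Sum>i\<in>I. (\<Sum>s\<in>R. g s * e s i)\<^sup>2) / 4 \<le> (\<Sum>s\<in>R. (g s)\<^sup>2) / 4"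
        by simp
      moreover have "(\<Sum>i\<in>I. (d i)\<^sup>2 * \<sigma>\<^sup>2 / 2) = (\<Sum>i\<in>I. (\<Sum>s\<in>R. g s * e s i)\<^sup>2) / 4"
        using s by (simp add: d_def power_mult_distrib c2 sum_divide_distrib)
      ultimately show ?thesis
        by (simp add: sum_divide_distrib)
    qed
    finally show "(\<integral>\<^sup>+u. ennreal (exp (\<Sum>s\<in>R. c * p s u * g s)) \<partial>?U) \<le> ennreal (exp (\<Sum>s\<in>R. (1 / 2) * (g s)\<^sup>2 / (2 * 1\<^sup>2)))"
      by simp
  qed
  also have "\<dots> = ennreal (exp (\<Sum>s\<in>R. - ln (1 - 1 / 2) / 2))"
    by (intro nn_integral_PiM_gaussian_exp_sum fin nn_integral_gaussian_exp_square) auto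
  also have "(\<Sum>s\<in>R. - ln (1 - 1 / 2 :: real) / 2) = real (card R) * (ln 2 / 2)"
    by (simp add: ln_div)
  finally show ?thesis
    unfolding p_def .
qed

text \<open>The loss \<open>2 * \<delta>\<close> is shared: if the distance is too small, then
  either \<open>u\<close> itself is short by a fraction \<open>\<delta>\<close>, or its projection
  onto the span carries at least a fraction \<open>\<delta>\<close> of the expected energy. The set
  \<open>F\<close> does not enter the bound.\<close>

lemma emeasure_gaussian_dist_subspace_le:
  fixes a :: "'s \<Rightarrow> 'i \<Rightarrow> real"
  assumes fin: "finite I" "finite R" and s: "\<sigma> > 0" and \<delta>: "0 < \<delta>" "\<delta> < 1"
  shows "emeasure (Pi\<^sub>M I (\<lambda>_. gaussian \<sigma>))
      {u \<in> space (Pi\<^sub>M I (\<lambda>_. borel)). \<exists>D\<in>F. (\<Sum>i\<in>I. (u i + (\<Sum>s\<in>R. D s * a s i))\<^sup>2) < real (card I) * \<sigma>\<^sup>2 * (1 - 2 * \<delta>)}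
    \<le> ennreal (exp (- (real (card I) * ((- \<delta> - ln (1 - \<delta>)) / 2))) +
        exp (real (card R) * (ln 2 / 2) - real (card I) * \<delta> / 4))"
proof -
  let ?U = "Pi\<^sub>M I (\<lambda>_. gaussian \<sigma>)"
  obtain e where orth: "\<And>s t. s \<in> R \<Longrightarrow> t \<in> R \<Longrightarrow> s \<noteq> t \<Longrightarrow> (\<Sum>i\<in>I. e s i * e t i) = 0"
    and unit: "\<And>s. s \<in> R \<Longrightarrow> (\<Sum>i\<in>I. (e s i)\<^sup>2) \<le> 1"
    and ge: "\<And>u D. (\<Sum>i\<in>I. (u i)\<^sup>2) - (\<Sum>s\<in>R. (\<Sum>i\<in>I. u i * e s i)\<^sup>2) \<le> (\<Sum>i\<in>I. (u i + (\<Sum>s\<in>R. D s * a s i))\<^sup>2)"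
    by (rule norm_add_span_ge[OF fin, of a]) (rule that)
  let ?E1 = "{u \<in> space ?U. (\<Sum>i\<in>I. (u i)\<^sup>2) \<le> real (card I) * \<sigma>\<^sup>2 * (1 - \<delta>)}"
  let ?E2 = "{u \<in> space ?U. (\<Sum>s\<in>R. (\<Sum>i\<in>I. u i * e s i)\<^sup>2 / (4 * \<sigma>\<^sup>2)) \<ge> real (card I) * \<delta> / 4}"
  let ?E = "{u \<in> space (Pi\<^sub>M I (\<lambda>_. borel)). \<exists>D\<in>F. (\<Sum>i\<in>I. (u i + (\<Sum>s\<in>R. D s * a s i))\<^sup>2) < real (card I) * \<sigma>\<^sup>2 * (1 - 2 * \<delta>)}"
  have "?E \<subseteq> ?E1 \<union> ?E2"
  proof
    fix u assume "u \<in> ?E"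
    then obtain D where u: "u \<in> space ?U"
      and D: "(\<Sum>i\<in>I. (u i + (\<Sum>s\<in>R. D s * a s i))\<^sup>2) < real (card I) * \<sigma>\<^sup>2 * (1 - 2 * \<delta>)"
      by (auto simp: space_PiM)
    define P where "P = (\<Sum>s\<in>R. (\<Sum>i\<in>I. u i * e s i)\<^sup>2)"
    have *: "(\<Sum>i\<in>I. (u i)\<^sup>2) < P + real (card I) * \<sigma>\<^sup>2 * (1 - 2 * \<delta>)"
      using ge[of u D] D by (simp add: P_def)
    have "u \<in> ?E1" if "P \<le> real (card I) * \<sigma>\<^sup>2 * \<delta>"
      using * that u by (auto simp: algebra_simps)
    moreover have "u \<in> ?E2" if "P \<ge> real (card I) * \<sigma>\<^sup>2 * \<delta>"
    proof -
      have "real (card I) * \<delta> / 4 = real (card I) * \<sigma>\<^sup>2 * \<delta> / (4 * \<sigma>\<^sup>2)"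
        using s by simp
      also have "\<dots> \<le> P / (4 * \<sigma>\<^sup>2)"
        using that by (intro divide_right_mono) auto
      finally show ?thesis
        using u by (simp add: P_def sum_divide_distrib)
    qed
    ultimately show "u \<in> ?E1 \<union> ?E2" by fastforce
  qed
  then have "emeasure ?U ?E \<le> emeasure ?U (?E1 \<union> ?E2)"
    by (intro emeasure_mono) measurable
  also have "\<dots> \<le> emeasure ?U ?E1 + emeasure ?U ?E2"
    by (intro emeasure_subadditive) measurable
  also have "\<dots> \<le> ennreal (exp (- (real (card I) * ((- \<delta> - ln (1 - \<delta>)) / 2)))) +
      ennreal (exp (real (card R) * (ln 2 / 2) - real (card I) * \<delta> / 4))"
    by (intro add_mono emeasure_gaussian_norm_le emeasure_le_exp_moment
          nn_integral_gaussian_exp_projection assms orth unit) auto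
  finally show ?thesis
    by (simp add: ennreal_plus[symmetric] del: ennreal_plus)
qed

text \<open>Chernoff's inequality for the exponent \<open>- |v - u|^2 / (2 \<tau>^2)\<close>. The
  Gaussian average of this test function is again Gaussian in \<open>v\<close>, with variance
  \<open>\<tau>\<^sup>2 + \<rho>\<^sup>2\<close>; this is the term that rewards a large
  \<open>v\<close>.\<close>

lemma emeasure_gaussian_ball_le:
  assumes fin: "finite I" and s: "\<rho> > 0" and t: "\<tau> > 0"
  shows "emeasure (Pi\<^sub>M I (\<lambda>_. gaussian \<rho>))
      {u \<in> space (Pi\<^sub>M I (\<lambda>_. borel)). (\<Sum>i\<in>I. (v i - u i)\<^sup>2) \<le> 2 * \<tau>\<^sup>2 * r}
    \<le> ennreal (exp (- (real (card I) * ln (1 + \<rho>\<^sup>2 / \<tau>\<^sup>2) / 2) - (\<Sum>i\<in>I. (v i)\<^sup>2) / (2 * (\<tau>\<^sup>2 + \<rho>\<^sup>2)) + r))"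
proof -
  let ?U = "Pi\<^sub>M I (\<lambda>_. gaussian \<rho>)"
  have mgf: "(\<integral>\<^sup>+u. ennreal (exp (\<Sum>i\<in>I. - (v i - u i)\<^sup>2 / (2 * \<tau>\<^sup>2))) \<partial>?U)
     = ennreal (exp (\<Sum>i\<in>I. - ln (1 + \<rho>\<^sup>2 / \<tau>\<^sup>2) / 2 - (v i)\<^sup>2 / (2 * (\<tau>\<^sup>2 + \<rho>\<^sup>2))))"
    using s t by (intro nn_integral_PiM_gaussian_exp_sum fin nn_integral_gaussian_exp_distance) auto
  have sub: "{u \<in> space (Pi\<^sub>M I (\<lambda>_. borel)). (\<Sum>i\<in>I. (v i - u i)\<^sup>2) \<le> 2 * \<tau>\<^sup>2 * r}
     = {u \<in> space ?U. (\<Sum>i\<in>I. - (v i - u i)\<^sup>2 / (2 * \<tau>\<^sup>2)) \<ge> - r}"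
  proof -
    have "(\<Sum>i\<in>I. - (v i - u i)\<^sup>2 / (2 * \<tau>\<^sup>2)) = - ((\<Sum>i\<in>I. (v i - u i)\<^sup>2) / (2 * \<tau>\<^sup>2))" for u
      by (simp add: sum_negf sum_divide_distrib)
    then show ?thesis
      using t by (auto simp: space_PiM pos_divide_le_eq mult_ac)
  qed
  have "emeasure ?U {u \<in> space ?U. (\<Sum>i\<in>I. - (v i - u i)\<^sup>2 / (2 * \<tau>\<^sup>2)) \<ge> - r}
    \<le> ennreal (exp ((\<Sum>i\<in>I. - ln (1 + \<rho>\<^sup>2 / \<tau>\<^sup>2) / 2 - (v i)\<^sup>2 / (2 * (\<tau>\<^sup>2 + \<rho>\<^sup>2))) - - r))"
    by (rule emeasure_le_exp_moment) (use mgf in auto)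
  then show ?thesis
    unfolding sub by (simp add: sum_subtractf sum_negf sum_divide_distrib)
qed

section \<open>The failure events\<close>

text \<open>Column \<open>0\<close> carries the noise vector, columns \<open>1, \<dots>, m\<close> the measurement matrix.\<close>

definition noise_and_matrix :: "real \<Rightarrow> real \<Rightarrow> nat \<Rightarrow> nat \<Rightarrow> (nat \<times> nat \<Rightarrow> real) measure" where
  "noise_and_matrix \<sigma>\<^sub>a \<sigma>\<^sub>z n m = Pi\<^sub>M ({1..n} \<times> {0..m}) (\<lambda>j. gaussian (if snd j = 0 then \<sigma>\<^sub>z else \<sigma>\<^sub>a))"

lemma measurable_entry:
  assumes "i \<in> {1..n}" "s \<le> m"
  shows "(\<lambda>\<omega>. \<omega> (i, s)) \<in> borel_measurable (noise_and_matrix \<sigma>\<^sub>a \<sigma>\<^sub>z n m)"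
  using measurable_component_singleton[of "(i, s)" "{1..n} \<times> {0..m}" "\<lambda>j. gaussian (if snd j = 0 then \<sigma>\<^sub>z else \<sigma>\<^sub>a)"] assms
  by (simp add: noise_and_matrix_def cong: measurable_cong_sets)

lemma measurable_entry_combination:
  assumes "i \<in> {1..n}" "\<And>s. s \<in> K \<Longrightarrow> s \<le> m"
  shows "(\<lambda>\<omega>. \<Sum>s\<in>K. c s * \<omega> (i, s)) \<in> borel_measurable (noise_and_matrix \<sigma>\<^sub>a \<sigma>\<^sub>z n m)"
  using assms by (intro borel_measurable_sum borel_measurable_times measurable_entry) auto

lemma measurable_residual_norm:
  assumes "\<And>s. s \<in> K \<Longrightarrow> s \<le> m" "\<And>s. s \<in> L \<Longrightarrow> s \<le> m"
  shows "(\<lambda>\<omega>. \<Sum>i\<in>{1..n}. (\<omega> (i, 0) + (\<Sum>s\<in>K. c s * \<omega> (i, s)) + (\<Sum>s\<in>L. d s * \<omega> (i, s)))\<^sup>2)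
    \<in> borel_measurable (noise_and_matrix \<sigma>\<^sub>a \<sigma>\<^sub>z n m)"
  using assms
  by (intro borel_measurable_sum borel_measurable_power borel_measurable_add measurable_entry_combination measurable_entry) auto

text \<open>The residual of the true tuple is the noise, so outside this event the true tuple is
  accepted.\<close>

lemma emeasure_noise_large:
  assumes "\<sigma>\<^sub>a > 0" "\<sigma>\<^sub>z > 0" "n > 0" "\<delta> > 0"
  shows "{\<omega> \<in> space (noise_and_matrix \<sigma>\<^sub>a \<sigma>\<^sub>z n m). (\<Sum>i\<in>{1..n}. (\<omega> (i, 0))\<^sup>2) \<ge> real n * \<sigma>\<^sub>z\<^sup>2 * (1 + \<delta>)}
      \<in> sets (noise_and_matrix \<sigma>\<^sub>a \<sigma>\<^sub>z n m)" (is "?E \<in> _")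
    and "emeasure (noise_and_matrix \<sigma>\<^sub>a \<sigma>\<^sub>z n m)
      {\<omega> \<in> space (noise_and_matrix \<sigma>\<^sub>a \<sigma>\<^sub>z n m). (\<Sum>i\<in>{1..n}. (\<omega> (i, 0))\<^sup>2) \<ge> real n * \<sigma>\<^sub>z\<^sup>2 * (1 + \<delta>)}
    \<le> ennreal (exp (- (real n * ((\<delta> - ln (1 + \<delta>)) / 2))))"
proof -
  let ?N = "noise_and_matrix \<sigma>\<^sub>a \<sigma>\<^sub>z n m"
  let ?\<sigma> = "\<lambda>s::nat. if s = 0 then \<sigma>\<^sub>z else \<sigma>\<^sub>a"
  define Q :: "(nat \<times> nat \<Rightarrow> real) \<Rightarrow> (nat \<Rightarrow> real) \<Rightarrow> bool"
    where "Q = (\<lambda>x u. (\<Sum>i\<in>{1..n}. (u i)\<^sup>2) \<ge> real n * \<sigma>\<^sub>z\<^sup>2 * (1 + \<delta>))"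
  show E: "?E \<in> sets ?N"
    using measurable_residual_norm[where K="{}" and L="{}" and m=m and n=n] by simp
  have eq: "?E = {\<omega> \<in> space ?N. Q (restrict \<omega> ({1..n} \<times> ({0..m} - {0}))) (\<lambda>i\<in>{1..n}. \<Sum>s\<in>{0}. 1 * \<omega> (i, s))}"
    by (simp add: Q_def)
  have "emeasure ?N {\<omega> \<in> space ?N. Q (restrict \<omega> ({1..n} \<times> ({0..m} - {0}))) (\<lambda>i\<in>{1..n}. \<Sum>s\<in>{0}. 1 * \<omega> (i, s))}
    \<le> ennreal (exp (- (real n * ((\<delta> - ln (1 + \<delta>)) / 2))))"
    unfolding noise_and_matrix_def
  proof (rule emeasure_condition_on_columns[where \<sigma>="?\<sigma>"])
    show "{u \<in> space (Pi\<^sub>M {1..n} (\<lambda>_. borel)). Q x u} \<in> sets (Pi\<^sub>M {1..n} (\<lambda>_. borel))" for x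
      unfolding Q_def by measurable
    show "emeasure (Pi\<^sub>M {1..n} (\<lambda>_. gaussian (sqrt (\<Sum>s\<in>{0}. 1\<^sup>2 * (?\<sigma> s)\<^sup>2)))) {u \<in> space (Pi\<^sub>M {1..n} (\<lambda>_. borel)). Q x u}
       \<le> ennreal (exp (- (real n * ((\<delta> - ln (1 + \<delta>)) / 2))))" for x
      using emeasure_gaussian_norm_ge[of "{1..n}" \<sigma>\<^sub>z \<delta>] assms by (simp add: Q_def space_PiM)
    show "{\<omega> \<in> space (Pi\<^sub>M ({1..n} \<times> {0..m}) (\<lambda>j. gaussian (?\<sigma> (snd j)))).
        Q (restrict \<omega> ({1..n} \<times> ({0..m} - {0}))) (\<lambda>i\<in>{1..n}. \<Sum>s\<in>{0}. 1 * \<omega> (i, s))}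
        \<in> sets (Pi\<^sub>M ({1..n} \<times> {0..m}) (\<lambda>j. gaussian (?\<sigma> (snd j))))"
      using E[unfolded eq] unfolding noise_and_matrix_def .
  qed (use assms in auto)
  then show "emeasure ?N ?E \<le> ennreal (exp (- (real n * ((\<delta> - ln (1 + \<delta>)) / 2))))"
    unfolding eq .
qed

text \<open>The columns in \<open>S - R\<close> are frozen and span the subspace of
  \<open>emeasure_gaussian_dist_subspace_le\<close>, while noise and missed columns form the
  Gaussian vector. Finiteness of \<open>F\<close> gives measurability of the event; the bound is the
  same for every \<open>F\<close>.\<close>

lemma emeasure_missed_part_small:
  fixes F :: "(nat \<Rightarrow> real) set" and x :: "nat \<Rightarrow> real"
  assumes pos: "\<sigma>\<^sub>a > 0" "\<sigma>\<^sub>z > 0" "n > 0" and \<delta>: "0 < \<delta>" "\<delta> < 1"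
    and S: "S \<subseteq> {1..m}" "R \<subseteq> S" and F: "finite F"
  defines "E \<equiv> {\<omega> \<in> space (noise_and_matrix \<sigma>\<^sub>a \<sigma>\<^sub>z n m).
      \<exists>D\<in>F. (\<Sum>i\<in>{1..n}. (\<omega> (i, 0) + (\<Sum>s\<in>R. x s * \<omega> (i, s)) + (\<Sum>s\<in>S - R. D s * \<omega> (i, s)))\<^sup>2)
        < real n * (\<sigma>\<^sub>z\<^sup>2 + \<sigma>\<^sub>a\<^sup>2 * (\<Sum>s\<in>R. (x s)\<^sup>2)) * (1 - 2 * \<delta>)}"
  shows "E \<in> sets (noise_and_matrix \<sigma>\<^sub>a \<sigma>\<^sub>z n m)"
    and "emeasure (noise_and_matrix \<sigma>\<^sub>a \<sigma>\<^sub>z n m) E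
    \<le> ennreal (exp (- (real n * ((- \<delta> - ln (1 - \<delta>)) / 2))) +
        exp (real (card (S - R)) * (ln 2 / 2) - real n * \<delta> / 4))"
proof -
  let ?N = "noise_and_matrix \<sigma>\<^sub>a \<sigma>\<^sub>z n m"
  let ?\<sigma> = "\<lambda>s::nat. if s = 0 then \<sigma>\<^sub>z else \<sigma>\<^sub>a"
  let ?b = "ennreal (exp (- (real n * ((- \<delta> - ln (1 - \<delta>)) / 2))) +
        exp (real (card (S - R)) * (ln 2 / 2) - real n * \<delta> / 4))"
  define v where "v = \<sigma>\<^sub>z\<^sup>2 + \<sigma>\<^sub>a\<^sup>2 * (\<Sum>s\<in>R. (x s)\<^sup>2)"
  have v: "v > 0"
    using pos by (auto simp: v_def intro!: add_pos_nonneg mult_nonneg_nonneg sum_nonneg)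
  have fin: "finite S" "finite R" "0 \<notin> S" "0 \<notin> R"
    using S by (auto intro: finite_subset)
  \<comment> \<open>As column \<open>0\<close> with coefficient 1, the noise joins the missed
    columns in a single column combination.\<close>
  define K where "K = insert 0 R"
  define c where "c = x(0 := 1)"
  have KC: "K \<subseteq> {0..m}" using S by (auto simp: K_def)
  have cK: "(\<Sum>s\<in>K. (c s)\<^sup>2 * (?\<sigma> s)\<^sup>2) = v"
  proof -
    have "(\<Sum>s\<in>R. (c s)\<^sup>2 * (?\<sigma> s)\<^sup>2) = (\<Sum>s\<in>R. \<sigma>\<^sub>a\<^sup>2 * (x s)\<^sup>2)"
      using fin by (intro sum.cong) (auto simp: c_def)
    then show ?thesis
      using fin by (simp add: K_def v_def sum_distrib_left) (simp add: c_def)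
  qed
  have cw: "(\<Sum>s\<in>K. c s * \<omega> (i, s)) = \<omega> (i, 0) + (\<Sum>s\<in>R. x s * \<omega> (i, s))" for \<omega> :: "nat \<times> nat \<Rightarrow> real" and i
  proof -
    have "(\<Sum>s\<in>R. c s * \<omega> (i, s)) = (\<Sum>s\<in>R. x s * \<omega> (i, s))"
      using fin by (intro sum.cong) (auto simp: c_def)
    then show ?thesis
      using fin by (simp add: K_def) (simp add: c_def)
  qed
  define Q :: "(nat \<times> nat \<Rightarrow> real) \<Rightarrow> (nat \<Rightarrow> real) \<Rightarrow> bool"
    where "Q = (\<lambda>y u. \<exists>D\<in>F. (\<Sum>i\<in>{1..n}. (u i + (\<Sum>s\<in>S - R. D s * y (i, s)))\<^sup>2) < real n * v * (1 - 2 * \<delta>))"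
  show E: "E \<in> sets ?N"
  proof -
    have "E = (\<Union>D\<in>F. {\<omega> \<in> space ?N. (\<Sum>i\<in>{1..n}. (\<omega> (i, 0) + (\<Sum>s\<in>R. x s * \<omega> (i, s)) + (\<Sum>s\<in>S - R. D s * \<omega> (i, s)))\<^sup>2)
        < real n * v * (1 - 2 * \<delta>)})"
      by (auto simp: E_def v_def)
    also have "\<dots> \<in> sets ?N"
    proof (intro sets.finite_UN F)
      fix D
      have "(\<lambda>\<omega>. \<Sum>i\<in>{1..n}. (\<omega> (i, 0) + (\<Sum>s\<in>R. x s * \<omega> (i, s)) + (\<Sum>s\<in>S - R. D s * \<omega> (i, s)))\<^sup>2) \<in> borel_measurable ?N"
        using S by (intro measurable_residual_norm) auto
      then show "{\<omega> \<in> space ?N. (\<Sum>i\<in>{1..n}. (\<omega> (i, 0) + (\<Sum>s\<in>R. x s * \<omega> (i, s)) + (\<Sum>s\<in>S - R. D s * \<omega> (i, s)))\<^sup>2)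
        < real n * v * (1 - 2 * \<delta>)} \<in> sets ?N"
        by measurable
    qed
    finally show ?thesis .
  qed
  have eq: "E = {\<omega> \<in> space ?N. Q (restrict \<omega> ({1..n} \<times> ({0..m} - K))) (\<lambda>i\<in>{1..n}. \<Sum>s\<in>K. c s * \<omega> (i, s))}"
  proof -
    have "(\<Sum>i\<in>{1..n}. ((\<lambda>i\<in>{1..n}. \<Sum>s\<in>K. c s * \<omega> (i, s)) i + (\<Sum>s\<in>S - R. D s * restrict \<omega> ({1..n} \<times> ({0..m} - K)) (i, s)))\<^sup>2)
       = (\<Sum>i\<in>{1..n}. (\<omega> (i, 0) + (\<Sum>s\<in>R. x s * \<omega> (i, s)) + (\<Sum>s\<in>S - R. D s * \<omega> (i, s)))\<^sup>2)" for D and \<omega> :: "nat \<times> nat \<Rightarrow> real"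
    proof (rule sum.cong[OF refl])
      fix i assume i: "i \<in> {1..n}"
      have "(\<Sum>s\<in>S - R. D s * restrict \<omega> ({1..n} \<times> ({0..m} - K)) (i, s)) = (\<Sum>s\<in>S - R. D s * \<omega> (i, s))"
      proof (rule sum.cong[OF refl])
        fix s assume "s \<in> S - R"
        then have "s \<in> {0..m} - K"
          using S fin by (auto simp: K_def)
        with i show "D s * restrict \<omega> ({1..n} \<times> ({0..m} - K)) (i, s) = D s * \<omega> (i, s)"
          by simp
      qed
      then show "((\<lambda>i\<in>{1..n}. \<Sum>s\<in>K. c s * \<omega> (i, s)) i + (\<Sum>s\<in>S - R. D s * restrict \<omega> ({1..n} \<times> ({0..m} - K)) (i, s)))\<^sup>2
        = (\<omega> (i, 0) + (\<Sum>s\<in>R. x s * \<omega> (i, s)) + (\<Sum>s\<in>S - R. D s * \<omega> (i, s)))\<^sup>2"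
        using i cw by simp
    qed
    then show ?thesis
      by (simp add: Q_def E_def v_def)
  qed
  have "emeasure ?N {\<omega> \<in> space ?N. Q (restrict \<omega> ({1..n} \<times> ({0..m} - K))) (\<lambda>i\<in>{1..n}. \<Sum>s\<in>K. c s * \<omega> (i, s))} \<le> ?b"
    unfolding noise_and_matrix_def
  proof (rule emeasure_condition_on_columns[where \<sigma>="?\<sigma>"])
    show "{u \<in> space (Pi\<^sub>M {1..n} (\<lambda>_. borel)). Q y u} \<in> sets (Pi\<^sub>M {1..n} (\<lambda>_. borel))" for y
      unfolding Q_def using F by measurable
    show "emeasure (Pi\<^sub>M {1..n} (\<lambda>_. gaussian (sqrt (\<Sum>s\<in>K. (c s)\<^sup>2 * (?\<sigma> s)\<^sup>2)))) {u \<in> space (Pi\<^sub>M {1..n} (\<lambda>_. borel)). Q y u}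
       \<le> ?b" for y
      using emeasure_gaussian_dist_subspace_le[of "{1..n}" "S - R" "sqrt v" \<delta> F "\<lambda>s i. y (i, s)"] v \<delta> fin
      unfolding cK by (simp add: Q_def)
    show "{\<omega> \<in> space (Pi\<^sub>M ({1..n} \<times> {0..m}) (\<lambda>j. gaussian (?\<sigma> (snd j)))).
        Q (restrict \<omega> ({1..n} \<times> ({0..m} - K))) (\<lambda>i\<in>{1..n}. \<Sum>s\<in>K. c s * \<omega> (i, s))}
        \<in> sets (Pi\<^sub>M ({1..n} \<times> {0..m}) (\<lambda>j. gaussian (?\<sigma> (snd j))))"
      using E[unfolded eq] unfolding noise_and_matrix_def .
    show "0 < (\<Sum>s\<in>K. (c s)\<^sup>2 * (?\<sigma> s)\<^sup>2)"
      unfolding cK by (rule v)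
  qed (use pos KC in auto)
  then show "emeasure ?N E \<le> ?b"
    unfolding eq .
qed

lemma emeasure_false_part_fits:
  fixes x d :: "nat \<Rightarrow> real" and q r :: real
  assumes pos: "\<sigma>\<^sub>a > 0" "\<sigma>\<^sub>z > 0" "n > 0"
    and S: "S \<subseteq> {1..m}" "T \<subseteq> {1..m}" "S \<inter> T = {}"
    and xT: "(\<Sum>s\<in>T. (x s)\<^sup>2) > 0"
  defines "E \<equiv> {\<omega> \<in> space (noise_and_matrix \<sigma>\<^sub>a \<sigma>\<^sub>z n m).
      (\<Sum>i\<in>{1..n}. (\<omega> (i, 0) + (\<Sum>s\<in>S. d s * \<omega> (i, s)) - (\<Sum>s\<in>T. x s * \<omega> (i, s)))\<^sup>2) \<le> 2 * \<sigma>\<^sub>z\<^sup>2 * r \<and>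
      q \<le> (\<Sum>i\<in>{1..n}. (\<omega> (i, 0) + (\<Sum>s\<in>S. d s * \<omega> (i, s)))\<^sup>2)}"
  shows "E \<in> sets (noise_and_matrix \<sigma>\<^sub>a \<sigma>\<^sub>z n m)"
    and "emeasure (noise_and_matrix \<sigma>\<^sub>a \<sigma>\<^sub>z n m) E
    \<le> ennreal (exp (- (real n * ln (1 + \<sigma>\<^sub>a\<^sup>2 * (\<Sum>s\<in>T. (x s)\<^sup>2) / \<sigma>\<^sub>z\<^sup>2) / 2)
        - q / (2 * (\<sigma>\<^sub>z\<^sup>2 + \<sigma>\<^sub>a\<^sup>2 * (\<Sum>s\<in>T. (x s)\<^sup>2))) + r))"
proof -
  let ?N = "noise_and_matrix \<sigma>\<^sub>a \<sigma>\<^sub>z n m"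
  let ?\<sigma> = "\<lambda>s::nat. if s = 0 then \<sigma>\<^sub>z else \<sigma>\<^sub>a"
  define v where "v = \<sigma>\<^sub>a\<^sup>2 * (\<Sum>s\<in>T. (x s)\<^sup>2)"
  let ?b = "ennreal (exp (- (real n * ln (1 + v / \<sigma>\<^sub>z\<^sup>2) / 2) - q / (2 * (\<sigma>\<^sub>z\<^sup>2 + v)) + r))"
  have v: "v > 0"
    using pos xT by (auto simp: v_def)
  have fin: "finite S" "finite T" "0 \<notin> S" "0 \<notin> T"
    using S by (auto intro: finite_subset)
  have TC: "T \<subseteq> {0..m}" using S by auto
  have cT: "(\<Sum>s\<in>T. (x s)\<^sup>2 * (?\<sigma> s)\<^sup>2) = v"
    unfolding v_def sum_distrib_left using fin by (intro sum.cong) auto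
  define V where "V y i = y (i, 0) + (\<Sum>s\<in>S. d s * y (i, s))" for y :: "nat \<times> nat \<Rightarrow> real" and i :: nat
  define Q :: "(nat \<times> nat \<Rightarrow> real) \<Rightarrow> (nat \<Rightarrow> real) \<Rightarrow> bool"
    where "Q = (\<lambda>y u. (\<Sum>i\<in>{1..n}. (V y i - u i)\<^sup>2) \<le> 2 * \<sigma>\<^sub>z\<^sup>2 * r \<and> q \<le> (\<Sum>i\<in>{1..n}. (V y i)\<^sup>2))"
  show E: "E \<in> sets ?N"
  proof -
    have "(\<lambda>\<omega>. \<Sum>i\<in>{1..n}. (\<omega> (i, 0) + (\<Sum>s\<in>S. d s * \<omega> (i, s)) - (\<Sum>s\<in>T. x s * \<omega> (i, s)))\<^sup>2) \<in> borel_measurable ?N"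
      "(\<lambda>\<omega>. \<Sum>i\<in>{1..n}. (\<omega> (i, 0) + (\<Sum>s\<in>S. d s * \<omega> (i, s)))\<^sup>2) \<in> borel_measurable ?N"
      using S by (intro borel_measurable_sum borel_measurable_power borel_measurable_add borel_measurable_diff
          measurable_entry_combination measurable_entry; auto)+
    then show ?thesis
      unfolding E_def by measurable
  qed
  have eq: "E = {\<omega> \<in> space ?N. Q (restrict \<omega> ({1..n} \<times> ({0..m} - T))) (\<lambda>i\<in>{1..n}. \<Sum>s\<in>T. x s * \<omega> (i, s))}"
  proof -
    have "V (restrict \<omega> ({1..n} \<times> ({0..m} - T))) i = V \<omega> i" if i: "i \<in> {1..n}" for i and \<omega> :: "nat \<times> nat \<Rightarrow> real"
    proof -
      have "s \<in> {0..m} - T" if "s \<in> insert 0 S" for s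
        using S fin that by auto
      with i show ?thesis
        by (auto simp: V_def intro!: sum.cong)
    qed
    then show ?thesis
      by (simp add: Q_def E_def) (simp add: V_def)
  qed
  have "emeasure ?N {\<omega> \<in> space ?N. Q (restrict \<omega> ({1..n} \<times> ({0..m} - T))) (\<lambda>i\<in>{1..n}. \<Sum>s\<in>T. x s * \<omega> (i, s))} \<le> ?b"
    unfolding noise_and_matrix_def
  proof (rule emeasure_condition_on_columns[where \<sigma>="?\<sigma>"])
    show meas: "{u \<in> space (Pi\<^sub>M {1..n} (\<lambda>_. borel)). Q y u} \<in> sets (Pi\<^sub>M {1..n} (\<lambda>_. borel))" for y
      unfolding Q_def by measurable
    show "emeasure (Pi\<^sub>M {1..n} (\<lambda>_. gaussian (sqrt (\<Sum>s\<in>T. (x s)\<^sup>2 * (?\<sigma> s)\<^sup>2)))) {u \<in> space (Pi\<^sub>M {1..n} (\<lambda>_. borel)). Q y u}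
       \<le> ?b" for y
    proof (cases "q \<le> (\<Sum>i\<in>{1..n}. (V y i)\<^sup>2)")
      case True
      have "q / (2 * (\<sigma>\<^sub>z\<^sup>2 + v)) \<le> (\<Sum>i\<in>{1..n}. (V y i)\<^sup>2) / (2 * (\<sigma>\<^sub>z\<^sup>2 + v))"
        using True v by (intro divide_right_mono) auto
      then have "ennreal (exp (- (real n * ln (1 + v / \<sigma>\<^sub>z\<^sup>2) / 2) - (\<Sum>i\<in>{1..n}. (V y i)\<^sup>2) / (2 * (\<sigma>\<^sub>z\<^sup>2 + v)) + r)) \<le> ?b"
        by (intro ennreal_leI) simp
      moreover have "emeasure (Pi\<^sub>M {1..n} (\<lambda>_. gaussian (sqrt v))) {u \<in> space (Pi\<^sub>M {1..n} (\<lambda>_. borel)). Q y u}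
        \<le> ennreal (exp (- (real n * ln (1 + v / \<sigma>\<^sub>z\<^sup>2) / 2) - (\<Sum>i\<in>{1..n}. (V y i)\<^sup>2) / (2 * (\<sigma>\<^sub>z\<^sup>2 + v)) + r))"
        using emeasure_gaussian_ball_le[of "{1..n}" "sqrt v" \<sigma>\<^sub>z "V y" r] True v pos by (simp add: Q_def)
      ultimately show ?thesis
        unfolding cT by (rule order_trans[rotated])
    qed (simp add: Q_def)
    show "{\<omega> \<in> space (Pi\<^sub>M ({1..n} \<times> {0..m}) (\<lambda>j. gaussian (?\<sigma> (snd j)))).
        Q (restrict \<omega> ({1..n} \<times> ({0..m} - T))) (\<lambda>i\<in>{1..n}. \<Sum>s\<in>T. x s * \<omega> (i, s))}
        \<in> sets (Pi\<^sub>M ({1..n} \<times> {0..m}) (\<lambda>j. gaussian (?\<sigma> (snd j))))"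
      using E[unfolded eq] unfolding noise_and_matrix_def .
    show "0 < (\<Sum>s\<in>T. (x s)\<^sup>2 * (?\<sigma> s)\<^sup>2)"
      unfolding cT by (rule v)
  qed (use pos TC in auto)
  then show "emeasure ?N E \<le> ennreal (exp (- (real n * ln (1 + \<sigma>\<^sub>a\<^sup>2 * (\<Sum>s\<in>T. (x s)\<^sup>2) / \<sigma>\<^sub>z\<^sup>2) / 2)
        - q / (2 * (\<sigma>\<^sub>z\<^sup>2 + \<sigma>\<^sub>a\<^sup>2 * (\<Sum>s\<in>T. (x s)\<^sup>2))) + r))"
    unfolding eq v_def .
qed

section \<open>Comparison of exponents and counting of competing tuples\<close>

lemma false_part_exponent_le:
  fixes a p p' \<delta> :: real
  assumes "0 \<le> a" "a \<le> p" "a \<le> p'" "0 \<le> \<delta>" "2 * \<delta> \<le> 1"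
  shows "ln (1 + a) - 3 * \<delta> \<le> ln (1 + p') + (1 + p) * (1 - 2 * \<delta>) / (1 + p') - (1 + \<delta>)"
proof -
  \<comment> \<open>The ratio by which \<open>ln (1 + p')\<close> exceeds \<open>ln (1 + a)\<close>;
    the inequality \<open>ln t \<le> t - 1\<close> pays for this excess with the quotient term. As
    \<open>t \<le> 1\<close>, the total loss is \<open>\<delta>\<close> from the acceptance
    threshold and at most \<open>2 * \<delta>\<close> from the lower bound on
    \<open>V\<close>.\<close>
  define t where "t = (1 + a) / (1 + p')"
  have t: "0 < t" "t \<le> 1"
    using assms by (auto simp: t_def)
  have "ln (1 + a) = ln (1 + p') + ln t"
    using assms by (simp add: t_def ln_div)
  moreover have "ln t \<le> t - 1"
    using t by (intro ln_le_minus_one)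
  moreover have "t * (1 - 2 * \<delta>) \<le> (1 + p) * (1 - 2 * \<delta>) / (1 + p')"
    using assms by (auto simp: t_def intro!: divide_right_mono mult_right_mono)
  moreover have "t * (2 * \<delta>) \<le> 1 * (2 * \<delta>)"
    using assms t by (intro mult_right_mono) auto
  ultimately show ?thesis
    by (simp add: algebra_simps)
qed

text \<open>By injectivity exactly \<open>j\<close> positions hold indices outside \<open>B\<close>.
  They can be chosen in at most \<open>k ^ j\<close> ways and filled in at most \<open>m ^ j\<close>
  ways; each of the other \<open>k - j\<close> positions holds one of at most \<open>k\<close>
  elements of \<open>B\<close>.\<close>

lemma card_injective_tuples_le:
  assumes B: "finite B" "card B \<le> k"
  shows "card {S \<in> injective_tuples k m. card (S ` {1..k} - B) = j} \<le> k ^ k * m ^ j"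
proof (cases "j \<le> k")
  case False
  have "card (S ` {1..k} - B) \<le> k" for S
    using card_mono[of "S ` {1..k}" "S ` {1..k} - B"] card_image_le[of "{1..k}" S] by simp
  with False have none: "{S \<in> injective_tuples k m. card (S ` {1..k} - B) = j} = {}"
    by auto
  show ?thesis unfolding none by simp
next
  case True
  let ?\<P> = "{P. P \<subseteq> {1..k} \<and> card P = j}"
  let ?T = "\<lambda>P. PiE {1..k} (\<lambda>i. if i \<in> P then {1..m} else B)"
  have sub: "{S \<in> injective_tuples k m. card (S ` {1..k} - B) = j} \<subseteq> (\<Union>P\<in>?\<P>. ?T P)"
  proof
    fix S assume "S \<in> {S \<in> injective_tuples k m. card (S ` {1..k} - B) = j}"
    then have S: "S \<in> {1..k} \<rightarrow>\<^sub>E {1..m}" "inj_on S {1..k}" "card (S ` {1..k} - B) = j"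
      by (auto simp: injective_tuples_def)
    define P where "P = {i \<in> {1..k}. S i \<notin> B}"
    have "S ` P = S ` {1..k} - B"
      by (auto simp: P_def)
    moreover have "card (S ` P) = card P"
      by (intro card_image inj_on_subset[OF S(2)]) (auto simp: P_def)
    ultimately have "P \<in> ?\<P>"
      using S(3) by (auto simp: P_def)
    moreover have "S \<in> ?T P"
      using S(1) by (auto simp: P_def PiE_iff)
    ultimately show "S \<in> (\<Union>P\<in>?\<P>. ?T P)" by blast
  qed
  have card_T: "card (?T P) \<le> m ^ j * k ^ (k - j)" if P: "P \<in> ?\<P>" for P
  proof -
    have P': "P \<subseteq> {1..k}" "card P = j" using P by auto
    then have "finite P" using finite_subset by blast
    have "card (?T P) = (\<Prod>i\<in>{1..k}. card (if i \<in> P then {1..m} else B))"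
      by (simp add: card_PiE)
    also have "\<dots> = (\<Prod>i\<in>P. m) * (\<Prod>i\<in>{1..k} - P. card B)"
      by (subst prod.subset_diff[OF P'(1)]) auto
    also have "\<dots> = m ^ j * card B ^ (k - j)"
      using P' \<open>finite P\<close> by (simp add: card_Diff_subset)
    also have "\<dots> \<le> m ^ j * k ^ (k - j)"
      using B by (intro mult_left_mono power_mono) auto
    finally show ?thesis .
  qed
  have fin\<P>: "finite ?\<P>" by auto
  have "finite (\<Union>P\<in>?\<P>. ?T P)"
    using B fin\<P> by (intro finite_UN_I finite_PiE) auto
  then have "card {S \<in> injective_tuples k m. card (S ` {1..k} - B) = j} \<le> card (\<Union>P\<in>?\<P>. ?T P)"
    using sub by (intro card_mono)
  also have "\<dots> \<le> (\<Sum>P\<in>?\<P>. card (?T P))"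
    by (intro card_UN_le fin\<P>)
  also have "\<dots> \<le> (\<Sum>P\<in>?\<P>. m ^ j * k ^ (k - j))"
    by (intro sum_mono card_T)
  also have "\<dots> = (k choose j) * (m ^ j * k ^ (k - j))"
    by (simp add: n_subsets)
  also have "\<dots> \<le> k ^ j * (m ^ j * k ^ (k - j))"
    using True by (intro mult_right_mono binomial_le_pow) auto
  also have "\<dots> = k ^ k * m ^ j"
    using True by (simp add: power_add[symmetric])
  finally show ?thesis .
qed

section \<open>Signal energy on a set of indices, and the union bound\<close>

lemma signal_image:
  assumes "S \<in> injective_tuples k m" "s \<in> S ` {1..k}"
  obtains j where "j \<in> {1..k}" "signal m k w S s = w j"
proof -
  obtain j where j: "j \<in> {1..k}" "s = S j"
    using assms(2) by auto
  then have "signal m k w S s = w j"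
    using assms by (auto simp: signal_def injective_tuples_def the_inv_into_f_f)
  with j show ?thesis using that by blast
qed

lemma signal_eq_0:
  assumes "s \<in> {1..m}" "s \<notin> S ` {1..k}"
  shows "signal m k w S s = 0"
  using assms by (simp add: signal_def)

lemma sum_signal_squares_ge:
  assumes S: "S \<in> injective_tuples k m" and w: "\<And>j. j \<in> {1..k} \<Longrightarrow> w\<^sub>0 \<le> \<bar>w j\<bar>" "w\<^sub>0 > 0"
    and R: "R \<subseteq> S ` {1..k}"
  shows "real (card R) * w\<^sub>0\<^sup>2 \<le> (\<Sum>s\<in>R. (signal m k w S s)\<^sup>2)"
proof -
  have "(\<Sum>s\<in>R. w\<^sub>0\<^sup>2) \<le> (\<Sum>s\<in>R. (signal m k w S s)\<^sup>2)"
  proof (intro sum_mono)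
    fix s assume "s \<in> R"
    then obtain j where j: "j \<in> {1..k}" "signal m k w S s = w j"
      using signal_image[OF S, of s w] R by blast
    have "w\<^sub>0\<^sup>2 \<le> \<bar>w j\<bar>\<^sup>2"
      using w j by (intro power_mono) auto
    then show "w\<^sub>0\<^sup>2 \<le> (signal m k w S s)\<^sup>2"
      using j by simp
  qed
  then show ?thesis by simp
qed

text \<open>The summands belong to the three kinds of failure: too much noise, a small
  \<open>V\<close> for one of the \<open>2 ^ k\<close> missed sets, and a wrong tuple that fits,
  sorted by its number \<open>j\<close> of false indices. The argument \<open>x\<close> is the
  minimal signal-to-noise ratio of one index.\<close>

definition error_bound :: "real \<Rightarrow> real \<Rightarrow> nat \<Rightarrow> nat \<Rightarrow> nat \<Rightarrow> real" where
  "error_bound \<delta> x n m k = exp (- (real n * ((\<delta> - ln (1 + \<delta>)) / 2)))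
     + 2 ^ k * (exp (- (real n * ((- \<delta> - ln (1 - \<delta>)) / 2))) + exp (real k * (ln 2 / 2) - real n * \<delta> / 4))
     + (\<Sum>j\<in>{1..k}. real k ^ k * real m ^ j * exp (- (real n / 2 * (ln (1 + real j * x) - 3 * \<delta>))))"

lemma error_bound_nonneg: "0 \<le> error_bound \<delta> x n m k"
  unfolding error_bound_def by (intro add_nonneg_nonneg sum_nonneg mult_nonneg_nonneg) auto

text \<open>Union bound over \<open>E1\<close>, the \<open>E2 R\<close> and the
  \<open>E3 S'\<close>. A fitting wrong tuple \<open>S'\<close> lies in \<open>E2 R\<close> for its
  missed set \<open>R\<close> if its \<open>V\<close> is small, and in \<open>E3 S'\<close>
  otherwise.\<close>

lemma emeasure_decoding_failure_le:
  fixes w :: "nat \<Rightarrow> real" and S :: "nat \<Rightarrow> nat"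
  assumes pos: "\<sigma>\<^sub>a > 0" "\<sigma>\<^sub>z > 0" "n > 0" and \<delta>: "0 < \<delta>" "2 * \<delta> \<le> 1"
    and w: "\<And>j. j \<in> {1..k} \<Longrightarrow> w\<^sub>0 \<le> \<bar>w j\<bar>" "w\<^sub>0 > 0"
    and S: "S \<in> injective_tuples k m"
  defines "fits \<equiv> \<lambda>\<omega> S'. (\<Sum>i\<in>{1..n}. (\<omega> (i, 0) + (\<Sum>s\<in>{1..m}. (signal m k w S s - signal m k w S' s) * \<omega> (i, s)))\<^sup>2)
      \<le> real n * \<sigma>\<^sub>z\<^sup>2 * (1 + \<delta>)"
  shows "emeasure (noise_and_matrix \<sigma>\<^sub>a \<sigma>\<^sub>z n m) {\<omega> \<in> space (noise_and_matrix \<sigma>\<^sub>a \<sigma>\<^sub>z n m).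
      \<not> fits \<omega> S \<or> (\<exists>S'\<in>injective_tuples k m. S' ` {1..k} \<noteq> S ` {1..k} \<and> fits \<omega> S')}
    \<le> ennreal (error_bound \<delta> (w\<^sub>0\<^sup>2 * \<sigma>\<^sub>a\<^sup>2 / \<sigma>\<^sub>z\<^sup>2) n m k)"
proof -
  let ?N = "noise_and_matrix \<sigma>\<^sub>a \<sigma>\<^sub>z n m"
  let ?B = "S ` {1..k}"
  define X where "X = signal m k w"
  define x where "x = w\<^sub>0\<^sup>2 * \<sigma>\<^sub>a\<^sup>2 / \<sigma>\<^sub>z\<^sup>2"
  have x: "x \<ge> 0" by (simp add: x_def)
  \<comment> \<open>All differences of signals that can occur: with them, \<open>E2 R\<close> covers
    every \<open>S'\<close> whose missed set is \<open>R\<close>.\<close>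
  define F where "F = (\<lambda>S' s. X S s - X S' s) ` injective_tuples k m"
  \<comment> \<open>Tuples that only permute the true support are left out, because the decoder
    returns a set.\<close>
  define W where "W = {S' \<in> injective_tuples k m. S' ` {1..k} \<noteq> ?B}"
  define P where "P R = \<sigma>\<^sub>z\<^sup>2 + \<sigma>\<^sub>a\<^sup>2 * (\<Sum>s\<in>R. (X S s)\<^sup>2)" for R
  define E1 where "E1 = {\<omega> \<in> space ?N. (\<Sum>i\<in>{1..n}. (\<omega> (i, 0))\<^sup>2) \<ge> real n * \<sigma>\<^sub>z\<^sup>2 * (1 + \<delta>)}"
  define E2 where "E2 R = {\<omega> \<in> space ?N.
      \<exists>D\<in>F. (\<Sum>i\<in>{1..n}. (\<omega> (i, 0) + (\<Sum>s\<in>R. X S s * \<omega> (i, s)) + (\<Sum>s\<in>?B - R. D s * \<omega> (i, s)))\<^sup>2)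
        < real n * P R * (1 - 2 * \<delta>)}" for R
  \<comment> \<open>The radius is written as \<open>2 * \<sigma>\<^sub>z\<^sup>2 * r\<close> to
    match \<open>emeasure_false_part_fits\<close>.\<close>
  define E3 where "E3 S' = {\<omega> \<in> space ?N.
      (\<Sum>i\<in>{1..n}. (\<omega> (i, 0) + (\<Sum>s\<in>?B. (X S s - X S' s) * \<omega> (i, s)) - (\<Sum>s\<in>S' ` {1..k} - ?B. X S' s * \<omega> (i, s)))\<^sup>2)
        \<le> 2 * \<sigma>\<^sub>z\<^sup>2 * (real n * (1 + \<delta>) / 2) \<and>
      real n * P (?B - S' ` {1..k}) * (1 - 2 * \<delta>)
        \<le> (\<Sum>i\<in>{1..n}. (\<omega> (i, 0) + (\<Sum>s\<in>?B. (X S s - X S' s) * \<omega> (i, s)))\<^sup>2)}" for S'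
  define b where "b j = exp (- (real n / 2 * (ln (1 + real j * x) - 3 * \<delta>)))" for j :: nat
  have \<delta>1: "\<delta> < 1" using \<delta> by simp
  have B: "?B \<subseteq> {1..m}" "card ?B = k" "finite ?B"
    using S by (auto simp: injective_tuples_def card_image)
  have finF: "finite F" and finW: "finite W"
    by (auto simp: F_def W_def finite_injective_tuples)
  have E1: "E1 \<in> sets ?N" "emeasure ?N E1 \<le> ennreal (exp (- (real n * ((\<delta> - ln (1 + \<delta>)) / 2))))"
    unfolding E1_def using emeasure_noise_large[OF pos \<delta>(1)] by auto
  have E2: "E2 R \<in> sets ?N"
    "emeasure ?N (E2 R) \<le> ennreal (exp (- (real n * ((- \<delta> - ln (1 - \<delta>)) / 2))) + exp (real k * (ln 2 / 2) - real n * \<delta> / 4))"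
    if R: "R \<in> Pow ?B" for R
  proof -
    have R: "R \<subseteq> ?B" using R by auto
    show "E2 R \<in> sets ?N"
      unfolding E2_def P_def by (rule emeasure_missed_part_small[OF pos \<delta>(1) \<delta>1 B(1) R finF])
    have "card (?B - R) \<le> k"
      using card_mono[of ?B "?B - R"] B by auto
    then have "real (card (?B - R)) * (ln 2 / 2) \<le> real k * (ln 2 / 2)"
      by (intro mult_right_mono) auto
    then have "ennreal (exp (- (real n * ((- \<delta> - ln (1 - \<delta>)) / 2))) + exp (real (card (?B - R)) * (ln 2 / 2) - real n * \<delta> / 4))
       \<le> ennreal (exp (- (real n * ((- \<delta> - ln (1 - \<delta>)) / 2))) + exp (real k * (ln 2 / 2) - real n * \<delta> / 4))"
      by (intro ennreal_leI add_left_mono) simp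
    with emeasure_missed_part_small(2)[OF pos \<delta>(1) \<delta>1 B(1) R finF, of "X S"]
    show "emeasure ?N (E2 R) \<le> ennreal (exp (- (real n * ((- \<delta> - ln (1 - \<delta>)) / 2))) + exp (real k * (ln 2 / 2) - real n * \<delta> / 4))"
      unfolding E2_def P_def by (rule order_trans)
  qed
  have W: "card (?B - S' ` {1..k}) = card (S' ` {1..k} - ?B)" "card (S' ` {1..k} - ?B) \<in> {1..k}"
      "S' ` {1..k} \<subseteq> {1..m}" if "S' \<in> W" for S'
  proof -
    have S': "S' ` {1..k} \<subseteq> {1..m}" "card (S' ` {1..k}) = k" "finite (S' ` {1..k})" "S' ` {1..k} \<noteq> ?B"
      using that by (auto simp: W_def injective_tuples_def card_image)
    show "S' ` {1..k} \<subseteq> {1..m}" by fact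
    show "card (?B - S' ` {1..k}) = card (S' ` {1..k} - ?B)"
      using B S' by (simp add: card_Diff_subset_Int Int_commute)
    \<comment> \<open>Two different sets of the same size \<open>k\<close>: neither contains the
      other, so there is at least one false index.\<close>
    have "\<not> S' ` {1..k} \<subseteq> ?B"
      using card_subset_eq[of ?B "S' ` {1..k}"] B S' by auto
    then have "card (S' ` {1..k} - ?B) > 0"
      using S' by (auto simp: card_gt_0_iff)
    moreover have "card (S' ` {1..k} - ?B) \<le> k"
      using card_mono[of "S' ` {1..k}" "S' ` {1..k} - ?B"] S' by auto
    ultimately show "card (S' ` {1..k} - ?B) \<in> {1..k}" by simp
  qed
  have E3: "E3 S' \<in> sets ?N" "emeasure ?N (E3 S') \<le> ennreal (b (card (S' ` {1..k} - ?B)))"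
    if S': "S' \<in> W" for S'
  proof -
    let ?T = "S' ` {1..k} - ?B" and ?R = "?B - S' ` {1..k}"
    have S't: "S' \<in> injective_tuples k m" using S' by (auto simp: W_def)
    have T: "?T \<subseteq> {1..m}" "?B \<inter> ?T = {}"
      using W(3)[OF S'] by auto
    define j where "j = card ?T"
    have j: "j > 0" "card ?R = j"
      using W(1,2)[OF S'] by (auto simp: j_def)
    define p where "p = \<sigma>\<^sub>a\<^sup>2 * (\<Sum>s\<in>?R. (X S s)\<^sup>2) / \<sigma>\<^sub>z\<^sup>2"
    define p' where "p' = \<sigma>\<^sub>a\<^sup>2 * (\<Sum>s\<in>?T. (X S' s)\<^sup>2) / \<sigma>\<^sub>z\<^sup>2"
    have "real j * w\<^sub>0\<^sup>2 \<le> (\<Sum>s\<in>?T. (X S' s)\<^sup>2)"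
      unfolding X_def j_def by (rule sum_signal_squares_ge[OF S't w]) auto
    moreover have "real j * w\<^sub>0\<^sup>2 > 0"
      using j w by simp
    moreover have "real j * w\<^sub>0\<^sup>2 \<le> (\<Sum>s\<in>?R. (X S s)\<^sup>2)"
      unfolding X_def j(2)[symmetric] by (rule sum_signal_squares_ge[OF S w]) auto
    ultimately have T0: "(\<Sum>s\<in>?T. (X S' s)\<^sup>2) > 0"
      and "\<sigma>\<^sub>a\<^sup>2 * (real j * w\<^sub>0\<^sup>2) / \<sigma>\<^sub>z\<^sup>2 \<le> p" "\<sigma>\<^sub>a\<^sup>2 * (real j * w\<^sub>0\<^sup>2) / \<sigma>\<^sub>z\<^sup>2 \<le> p'"
      unfolding p_def p'_def by (auto intro!: divide_right_mono mult_left_mono)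
    then have pp: "real j * x \<le> p" "real j * x \<le> p'"
      by (simp_all add: x_def mult_ac)
    note lem = emeasure_false_part_fits[OF pos B(1) T T0, where d="\<lambda>s. X S s - X S' s" and q="real n * P ?R * (1 - 2 * \<delta>)" and r="real n * (1 + \<delta>) / 2"]
    show "E3 S' \<in> sets ?N"
      unfolding E3_def by (rule lem(1))
    have "ln (1 + real j * x) - 3 * \<delta> \<le> ln (1 + p') + (1 + p) * (1 - 2 * \<delta>) / (1 + p') - (1 + \<delta>)"
      using pp x \<delta> by (intro false_part_exponent_le) auto
    then have "real n / 2 * (ln (1 + real j * x) - 3 * \<delta>) \<le> real n / 2 * (ln (1 + p') + (1 + p) * (1 - 2 * \<delta>) / (1 + p') - (1 + \<delta>))"
      by (intro mult_left_mono) auto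
    also have "\<dots> = real n * ln (1 + p') / 2 + real n / 2 * ((1 + p) * (1 - 2 * \<delta>) / (1 + p')) - real n * (1 + \<delta>) / 2"
      by (simp add: algebra_simps add_divide_distrib diff_divide_distrib)
    also have "real n / 2 * ((1 + p) * (1 - 2 * \<delta>) / (1 + p'))
        = real n * P ?R * (1 - 2 * \<delta>) / (2 * (\<sigma>\<^sub>z\<^sup>2 + \<sigma>\<^sub>a\<^sup>2 * (\<Sum>s\<in>?T. (X S' s)\<^sup>2)))"
    proof -
      have 1: "P ?R = \<sigma>\<^sub>z\<^sup>2 * (1 + p)" "\<sigma>\<^sub>z\<^sup>2 + \<sigma>\<^sub>a\<^sup>2 * (\<Sum>s\<in>?T. (X S' s)\<^sup>2) = \<sigma>\<^sub>z\<^sup>2 * (1 + p')"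
        using pos by (auto simp: P_def p_def p'_def algebra_simps)
      have "1 + p' > 0"
        using pp x order_trans[of 0 "real j * x" p'] by simp
      then show ?thesis
        unfolding 1 using pos by simp
    qed
    finally have "exp (- (real n * ln (1 + p') / 2)
        - real n * P ?R * (1 - 2 * \<delta>) / (2 * (\<sigma>\<^sub>z\<^sup>2 + \<sigma>\<^sub>a\<^sup>2 * (\<Sum>s\<in>?T. (X S' s)\<^sup>2))) + real n * (1 + \<delta>) / 2) \<le> b j"
      unfolding b_def by simp
    then show "emeasure ?N (E3 S') \<le> ennreal (b (card ?T))"
      unfolding E3_def j_def[symmetric] p'_def by (intro order_trans[OF lem(2)] ennreal_leI)
  qed
  have sub: "{\<omega> \<in> space ?N. \<not> fits \<omega> S \<or> (\<exists>S'\<in>injective_tuples k m. S' ` {1..k} \<noteq> ?B \<and> fits \<omega> S')}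
      \<subseteq> E1 \<union> ((\<Union>R\<in>Pow ?B. E2 R) \<union> (\<Union>S'\<in>W. E3 S'))"
  proof
    fix \<omega> assume "\<omega> \<in> {\<omega> \<in> space ?N. \<not> fits \<omega> S \<or> (\<exists>S'\<in>injective_tuples k m. S' ` {1..k} \<noteq> ?B \<and> fits \<omega> S')}"
    then consider "\<omega> \<in> space ?N" "\<not> fits \<omega> S" | S' where "\<omega> \<in> space ?N" "S' \<in> W" "fits \<omega> S'"
      unfolding W_def by blast
    then show "\<omega> \<in> E1 \<union> ((\<Union>R\<in>Pow ?B. E2 R) \<union> (\<Union>S'\<in>W. E3 S'))"
    proof cases
      case 1
      then have "\<omega> \<in> E1" by (simp add: fits_def E1_def)
      then show ?thesis by blast
    next
      case 2
      let ?T = "S' ` {1..k} - ?B" and ?R = "?B - S' ` {1..k}"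
      define V where "V i = \<omega> (i, 0) + (\<Sum>s\<in>?B. (X S s - X S' s) * \<omega> (i, s))" for i
      have all: "(\<Sum>s\<in>{1..m}. (X S s - X S' s) * \<omega> (i, s))
          = (\<Sum>s\<in>?B. (X S s - X S' s) * \<omega> (i, s)) - (\<Sum>s\<in>?T. X S' s * \<omega> (i, s))" for i
      proof -
        have "(\<Sum>s\<in>{1..m}. (X S s - X S' s) * \<omega> (i, s)) = (\<Sum>s\<in>?B \<union> ?T. (X S s - X S' s) * \<omega> (i, s))"
          using B W(3)[OF 2(2)] by (intro sum.mono_neutral_right) (auto simp: X_def signal_eq_0)
        also have "\<dots> = (\<Sum>s\<in>?B. (X S s - X S' s) * \<omega> (i, s)) + (\<Sum>s\<in>?T. (X S s - X S' s) * \<omega> (i, s))"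
          by (intro sum.union_disjoint) auto
        also have "(\<Sum>s\<in>?T. (X S s - X S' s) * \<omega> (i, s)) = (\<Sum>s\<in>?T. - (X S' s * \<omega> (i, s)))"
          using W(3)[OF 2(2)] by (intro sum.cong refl) (auto simp: X_def signal_eq_0)
        finally show ?thesis
          by (simp add: sum_negf)
      qed
      have part: "(\<Sum>s\<in>?B. (X S s - X S' s) * \<omega> (i, s))
          = (\<Sum>s\<in>?R. X S s * \<omega> (i, s)) + (\<Sum>s\<in>?B - ?R. (X S s - X S' s) * \<omega> (i, s))" for i
      proof -
        have "(\<Sum>s\<in>?R. (X S s - X S' s) * \<omega> (i, s)) = (\<Sum>s\<in>?R. X S s * \<omega> (i, s))"
        proof (intro sum.cong refl)
          fix s assume s: "s \<in> ?R"
          then have "X S' s = 0"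
            unfolding X_def using B by (intro signal_eq_0) blast+
          then show "(X S s - X S' s) * \<omega> (i, s) = X S s * \<omega> (i, s)" by simp
        qed
        then show ?thesis
          using sum.subset_diff[of ?R ?B "\<lambda>s. (X S s - X S' s) * \<omega> (i, s)"] B by simp
      qed
      show ?thesis
      \<comment> \<open>A small \<open>V\<close> is charged to the missed set only, a large one to
        the tuple itself.\<close>
      proof (cases "(\<Sum>i\<in>{1..n}. (V i)\<^sup>2) < real n * P ?R * (1 - 2 * \<delta>)")
        case True
        have D: "(\<lambda>s. X S s - X S' s) \<in> F"
          using 2 by (auto simp: F_def W_def)
        have "(\<Sum>i\<in>{1..n}. (\<omega> (i, 0) + (\<Sum>s\<in>?R. X S s * \<omega> (i, s))
            + (\<Sum>s\<in>?B - ?R. (X S s - X S' s) * \<omega> (i, s)))\<^sup>2) < real n * P ?R * (1 - 2 * \<delta>)"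
          using True unfolding V_def part by (simp only: add.assoc)
        then have "\<omega> \<in> E2 ?R"
          unfolding E2_def by (intro CollectI conjI 2(1) bexI[OF _ D])
        then show ?thesis by blast
      next
        case False
        have "(\<Sum>i\<in>{1..n}. (V i - (\<Sum>s\<in>?T. X S' s * \<omega> (i, s)))\<^sup>2) \<le> real n * \<sigma>\<^sub>z\<^sup>2 * (1 + \<delta>)"
          using 2(3) unfolding fits_def X_def[symmetric] all by (simp add: V_def algebra_simps)
        then have "\<omega> \<in> E3 S'"
          using 2(1) False unfolding E3_def by (simp add: V_def mult_ac)
        then show ?thesis using 2(2) by blast
      qed
    qed
  qed
  \<comment> \<open>The bound \<open>b\<close> depends on \<open>S'\<close> only through the number
    of false indices, so the sum is grouped by it.\<close>
  have count: "(\<Sum>S'\<in>W. b (card (S' ` {1..k} - ?B))) \<le> (\<Sum>j\<in>{1..k}. real k ^ k * real m ^ j * b j)"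
  proof -
    have "(\<Sum>S'\<in>W. b (card (S' ` {1..k} - ?B)))
        = (\<Sum>j\<in>{1..k}. \<Sum>S'\<in>{S' \<in> W. card (S' ` {1..k} - ?B) = j}. b (card (S' ` {1..k} - ?B)))"
      using W(2) finW by (intro sum.group[symmetric]) auto
    also have "\<dots> = (\<Sum>j\<in>{1..k}. real (card {S' \<in> W. card (S' ` {1..k} - ?B) = j}) * b j)"
      by (intro sum.cong refl) simp
    also have "\<dots> \<le> (\<Sum>j\<in>{1..k}. real k ^ k * real m ^ j * b j)"
    proof (intro sum_mono mult_right_mono)
      fix j
      have "card {S' \<in> W. card (S' ` {1..k} - ?B) = j} \<le> card {S' \<in> injective_tuples k m. card (S' ` {1..k} - ?B) = j}"
        by (intro card_mono) (auto simp: W_def finite_injective_tuples)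
      also have "\<dots> \<le> k ^ k * m ^ j"
        using B by (intro card_injective_tuples_le) auto
      finally have "real (card {S' \<in> W. card (S' ` {1..k} - ?B) = j}) \<le> real (k ^ k * m ^ j)"
        by (rule of_nat_mono)
      then show "real (card {S' \<in> W. card (S' ` {1..k} - ?B) = j}) \<le> real k ^ k * real m ^ j"
        by simp
    qed (simp add: b_def)
    finally show ?thesis .
  qed
  let ?e2 = "exp (- (real n * ((- \<delta> - ln (1 - \<delta>)) / 2))) + exp (real k * (ln 2 / 2) - real n * \<delta> / 4)"
  have "emeasure ?N {\<omega> \<in> space ?N. \<not> fits \<omega> S \<or> (\<exists>S'\<in>injective_tuples k m. S' ` {1..k} \<noteq> ?B \<and> fits \<omega> S')}
     \<le> emeasure ?N (E1 \<union> ((\<Union>R\<in>Pow ?B. E2 R) \<union> (\<Union>S'\<in>W. E3 S')))"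
    using E1 E2 E3 finW B by (intro emeasure_mono sub sets.Un sets.finite_UN) auto
  also have "\<dots> \<le> emeasure ?N E1 + (emeasure ?N (\<Union>R\<in>Pow ?B. E2 R) + emeasure ?N (\<Union>S'\<in>W. E3 S'))"
    using E1 E2 E3 finW B
    by (intro order_trans[OF emeasure_subadditive] add_left_mono emeasure_subadditive sets.Un sets.finite_UN) auto
  also have "\<dots> \<le> emeasure ?N E1 + ((\<Sum>R\<in>Pow ?B. emeasure ?N (E2 R)) + (\<Sum>S'\<in>W. emeasure ?N (E3 S')))"
    using E2 E3 finW B by (intro add_left_mono add_mono emeasure_subadditive_finite) auto
  also have "\<dots> \<le> ennreal (exp (- (real n * ((\<delta> - ln (1 + \<delta>)) / 2)))) +
      ((\<Sum>R\<in>Pow ?B. ennreal ?e2) + (\<Sum>S'\<in>W. ennreal (b (card (S' ` {1..k} - ?B)))))"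
    by (intro add_mono sum_mono E1 E2 E3)
  also have "(\<Sum>R\<in>Pow ?B. ennreal ?e2) = ennreal (2 ^ k * ?e2)"
    using B by (simp add: card_Pow ennreal_mult' ennreal_power[symmetric] del: ennreal_plus)
  also have "(\<Sum>S'\<in>W. ennreal (b (card (S' ` {1..k} - ?B)))) = ennreal (\<Sum>S'\<in>W. b (card (S' ` {1..k} - ?B)))"
    by (simp add: sum_ennreal b_def)
  also have "ennreal (exp (- (real n * ((\<delta> - ln (1 + \<delta>)) / 2)))) + (ennreal (2 ^ k * ?e2) + ennreal (\<Sum>S'\<in>W. b (card (S' ` {1..k} - ?B))))
     = ennreal (exp (- (real n * ((\<delta> - ln (1 + \<delta>)) / 2))) + (2 ^ k * ?e2 + (\<Sum>S'\<in>W. b (card (S' ` {1..k} - ?B)))))"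
  proof -
    have "ennreal u + (ennreal v + ennreal y) = ennreal (u + (v + y))" if "0 \<le> u" "0 \<le> v" "0 \<le> y" for u v y
      using that by simp
    from this show ?thesis
      by rule (simp_all add: b_def sum_nonneg)
  qed
  also have "\<dots> \<le> ennreal (error_bound \<delta> x n m k)"
    using count unfolding error_bound_def b_def by (intro ennreal_leI) simp
  finally show ?thesis
    unfolding x_def .
qed

section \<open>Asymptotics of the error bound\<close>

text \<open>Half of \<open>rate\<close> compares the number of tuples, written as an exponential,
  with \<open>c * n / 2 * ln (1 + j * x)\<close>. This leaves the margin \<open>1 - c\<close>, at
  least half of which survives the loss \<open>3 * \<delta>\<close>. The margin is smallest at
  \<open>j = 1\<close>, hence the common rate.\<close>

lemma sum_error_bound_le:
  fixes x c \<delta> :: real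
  assumes "x > 0" "c < 1" "3 * \<delta> \<le> (1 - c) * ln (1 + x) / 2" "n > 0" "k > 0" "k \<le> m"
    and rate: "\<And>j. j \<in> {1..k} \<Longrightarrow> 6 * real k * ln (real k) + 2 * real j * ln (real m) \<le> c * real n * ln (1 + real j * x)"
  shows "(\<Sum>j\<in>{1..k}. real k ^ k * real m ^ j * exp (- (real n / 2 * (ln (1 + real j * x) - 3 * \<delta>))))
    \<le> real k * exp (- (real n * ((1 - c) * ln (1 + x) / 4)))"
proof -
  have "real k ^ k * real m ^ j * exp (- (real n / 2 * (ln (1 + real j * x) - 3 * \<delta>)))
      \<le> exp (- (real n * ((1 - c) * ln (1 + x) / 4)))" if j: "j \<in> {1..k}" for j
  proof -
    let ?L = "ln (1 + real j * x)"
    have "real j * x \<ge> 1 * x"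
      using j \<open>x > 0\<close> by (intro mult_right_mono) auto
    then have "ln (1 + x) \<le> ?L"
      using \<open>x > 0\<close> by (intro ln_mono) auto
    then have "(1 - c) * ln (1 + x) \<le> (1 - c) * ?L"
      using \<open>c < 1\<close> by (intro mult_left_mono) auto
    then have "(1 - c) * ln (1 + x) / 2 \<le> (1 - c) * ?L - 3 * \<delta>"
      using assms(3) by linarith
    then have "real n / 2 * ((1 - c) * ln (1 + x) / 2) \<le> real n / 2 * ((1 - c) * ?L - 3 * \<delta>)"
      by (intro mult_left_mono) auto
    moreover have "real k * ln (real k) \<ge> 0"
      using \<open>k > 0\<close> by simp
    moreover have "real n / 2 * ((1 - c) * ?L - 3 * \<delta>) = real n / 2 * (?L - 3 * \<delta>) - c * real n * ?L / 2"
      by (simp add: field_simps)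
    ultimately have "real k * ln (real k) + real j * ln (real m) - real n / 2 * (?L - 3 * \<delta>)
        \<le> - (real n * ((1 - c) * ln (1 + x) / 4))"
      using rate[OF j] by simp
    moreover have "real k ^ k * real m ^ j * exp (- (real n / 2 * (?L - 3 * \<delta>)))
        = exp (real k * ln (real k) + real j * ln (real m) - real n / 2 * (?L - 3 * \<delta>))"
    proof -
      have "real k ^ k = exp (real k * ln (real k))" "real m ^ j = exp (real j * ln (real m))"
        using \<open>k > 0\<close> \<open>k \<le> m\<close> by (simp_all add: exp_of_nat_mult)
      then show ?thesis
        by (simp only: mult_exp_exp) simp
    qed
    ultimately show ?thesis by simp
  qed
  then have "(\<Sum>j\<in>{1..k}. real k ^ k * real m ^ j * exp (- (real n / 2 * (ln (1 + real j * x) - 3 * \<delta>))))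
      \<le> (\<Sum>j\<in>{1..k}. exp (- (real n * ((1 - c) * ln (1 + x) / 4))))"
    by (rule sum_mono)
  then show ?thesis by simp
qed

text \<open>The multiples of \<open>\<gamma>\<close> in the hypotheses leave room for the factors
  exponential in \<open>k\<close>: \<open>2 ^ k\<close> costs at most \<open>\<gamma> * n\<close> in
  the exponent, and the projection moment \<open>exp (k * (ln 2 / 2))\<close> at most half of
  that.\<close>

lemma error_bound_le:
  fixes x c \<delta> \<gamma> :: real
  assumes "x > 0" "c < 1" "3 * \<delta> \<le> (1 - c) * ln (1 + x) / 2" "n > 0" "k > 0" "k \<le> m"
    and "\<And>j. j \<in> {1..k} \<Longrightarrow> 6 * real k * ln (real k) + 2 * real j * ln (real m) \<le> c * real n * ln (1 + real j * x)"
    and \<gamma>: "\<gamma> \<le> (\<delta> - ln (1 + \<delta>)) / 2" "2 * \<gamma> \<le> (- \<delta> - ln (1 - \<delta>)) / 2" "3 * \<gamma> \<le> \<delta> / 4"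
    and k: "real k \<le> \<gamma> * real n" "k \<le> n"
  shows "error_bound \<delta> x n m k \<le> 3 * exp (- (real n * \<gamma>)) + real n * exp (- (real n * ((1 - c) * ln (1 + x) / 4)))"
proof -
  have ln2: "ln 2 \<le> (1::real)" "0 \<le> ln (2::real)"
    using ln_le_minus_one[of "2::real"] by auto
  have kl: "real k * ln 2 \<le> \<gamma> * real n"
    using k(1) mult_left_le[of "ln 2" "real k"] ln2 by simp
  have n\<gamma>: "real n * \<gamma> \<le> real n * ((\<delta> - ln (1 + \<delta>)) / 2)"
      "real n * (2 * \<gamma>) \<le> real n * ((- \<delta> - ln (1 - \<delta>)) / 2)" "real n * (3 * \<gamma>) \<le> real n * (\<delta> / 4)"
    using \<gamma> by (intro mult_left_mono; simp)+
  have pow: "2 ^ k = exp (real k * ln 2)"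
    by (simp add: exp_of_nat_mult)
  have "exp (- (real n * ((\<delta> - ln (1 + \<delta>)) / 2))) \<le> exp (- (real n * \<gamma>))"
    using n\<gamma>(1) by simp
  moreover have "2 ^ k * exp (- (real n * ((- \<delta> - ln (1 - \<delta>)) / 2))) \<le> exp (- (real n * \<gamma>))"
    unfolding pow exp_add[symmetric] using n\<gamma>(2) kl by (simp add: mult_ac)
  moreover have "2 ^ k * exp (real k * (ln 2 / 2) - real n * \<delta> / 4) \<le> exp (- (real n * \<gamma>))"
    unfolding pow exp_add[symmetric] using n\<gamma>(3) kl k(1) by (simp add: mult_ac)
  moreover have "real k * exp (- (real n * ((1 - c) * ln (1 + x) / 4))) \<le> real n * exp (- (real n * ((1 - c) * ln (1 + x) / 4)))"
    using k(2) by (intro mult_right_mono) auto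
  moreover have "(\<Sum>j\<in>{1..k}. real k ^ k * real m ^ j * exp (- (real n / 2 * (ln (1 + real j * x) - 3 * \<delta>))))
    \<le> real k * exp (- (real n * ((1 - c) * ln (1 + x) / 4)))"
    by (rule sum_error_bound_le) (use assms in auto)
  ultimately show ?thesis
    unfolding error_bound_def distrib_left by linarith
qed

lemma error_bound_tendsto_0:
  fixes n k :: "nat \<Rightarrow> nat" and x c \<delta> :: real
  assumes x: "x > 0" and c: "c < 1" and \<delta>: "\<delta> > 0" "2 * \<delta> \<le> 1" "3 * \<delta> \<le> (1 - c) * ln (1 + x) / 2"
    and rate: "\<forall>\<^sub>F m in sequentially. n m > 0 \<and> k m > 0 \<and> k m \<le> m \<and> (\<forall>j\<in>{1..k m}.
        6 * real (k m) * ln (real (k m)) + 2 * real j * ln (real m) \<le> c * real (n m) * ln (1 + real j * x))"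
  shows "(\<lambda>m. error_bound \<delta> x (n m) m (k m)) \<longlonglongrightarrow> 0"
proof -
  define L where "L = ln (1 + x)"
  have L: "L > 0" using x by (simp add: L_def)
  \<comment> \<open>The instance \<open>j = 1\<close> of \<open>rate\<close>.\<close>
  have n_ge: "\<forall>\<^sub>F m in sequentially. 6 * real (k m) * ln (real (k m)) + 2 * ln (real m) \<le> L * real (n m) \<and> k m > 0"
    using rate
  proof eventually_elim
    case (elim m)
    then have "6 * real (k m) * ln (real (k m)) + 2 * real 1 * ln (real m) \<le> c * real (n m) * ln (1 + real 1 * x)"
      by (intro elim[THEN conjunct2, THEN conjunct2, THEN conjunct2, THEN bspec]) auto
    also have "\<dots> = c * (real (n m) * L)"
      by (simp add: L_def)
    also have "\<dots> \<le> 1 * (real (n m) * L)"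
      using c L by (intro mult_right_mono) auto
    finally show ?case using elim by (simp add: mult_ac)
  qed
  have ln_top: "filterlim (\<lambda>m. ln (real m)) at_top sequentially"
    by (rule filterlim_compose[OF ln_at_top filterlim_real_sequentially])
  have small: "\<forall>\<^sub>F m in sequentially. real (k m) \<le> \<eta> * real (n m)" if \<eta>: "\<eta> > 0" for \<eta>
  proof -
    \<comment> \<open>Beyond this threshold \<open>ln k > L / (6 * \<eta>)\<close>, so the term
      \<open>6 * k * ln k\<close> alone forces \<open>k \<le> \<eta> * n\<close>. Below it
      \<open>k\<close> is bounded, and the growth of \<open>2 * ln m\<close> suffices.\<close>
    define K where "K = exp (L / (6 * \<eta>))"
    have "\<forall>\<^sub>F m in sequentially. ln (real m) \<ge> K * L / (2 * \<eta>)"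
      using ln_top by (simp add: filterlim_at_top)
    with n_ge show ?thesis
    proof eventually_elim
      case (elim m)
      have nonneg: "6 * real (k m) * ln (real (k m)) \<ge> 0" "0 \<le> K * L / (2 * \<eta>)"
        using elim \<eta> L by (auto simp: K_def)
      show ?case
      proof (cases "real (k m) \<le> K")
        case True
        have "K * L / \<eta> \<le> L * real (n m)"
          using elim nonneg by linarith
        then have "K \<le> \<eta> * real (n m)"
          using \<eta> L by (simp add: field_simps)
        with True show ?thesis by simp
      next
        case False
        then have "exp (L / (6 * \<eta>)) < real (k m)"
          by (simp add: K_def)
        then have "ln (exp (L / (6 * \<eta>))) < ln (real (k m))"
          using elim by (subst ln_less_cancel_iff) auto
        then have "L / (6 * \<eta>) < ln (real (k m))"
          by simp
        then have "6 * real (k m) * (L / (6 * \<eta>)) \<le> 6 * real (k m) * ln (real (k m))"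
          by (intro mult_left_mono) auto
        also have "\<dots> \<le> L * real (n m)"
          using elim nonneg by linarith
        finally show ?thesis
          using \<eta> L by (simp add: field_simps)
      qed
    qed
  qed
  have n_top: "filterlim (\<lambda>m. real (n m)) at_top sequentially"
  proof (rule filterlim_at_top_mono)
    show "filterlim (\<lambda>m. 2 / L * ln (real m)) at_top sequentially"
      using L by (intro filterlim_tendsto_pos_mult_at_top[OF tendsto_const _ ln_top]) auto
    show "\<forall>\<^sub>F m in sequentially. 2 / L * ln (real m) \<le> real (n m)"
      using n_ge
    proof eventually_elim
      case (elim m)
      have "6 * real (k m) * ln (real (k m)) \<ge> 0"
        using elim by auto
      with elim have "2 * ln (real m) \<le> L * real (n m)" by linarith
      then show ?case using L by (simp add: field_simps)
    qed
  qed
  \<comment> \<open>The divisors 4 and 12 come from the multiples \<open>2 * \<gamma>\<close> and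
    \<open>3 * \<gamma>\<close> in \<open>error_bound_le\<close>.\<close>
  define \<gamma> where "\<gamma> = Min {(\<delta> - ln (1 + \<delta>)) / 2, (- \<delta> - ln (1 - \<delta>)) / 4, \<delta> / 12}"
  have "ln (1 + \<delta>) < \<delta>"
    using \<delta> by (intro ln_add_one_self_less_self)
  \<comment> \<open>Strictness: \<open>ln y = y - 1\<close> holds only at
    \<open>y = 1\<close>.\<close>
  moreover have "ln (1 - \<delta>) < - \<delta>"
    using \<delta> ln_le_minus_one[of "1 - \<delta>"] ln_eq_minus_one[of "1 - \<delta>"]
    by (cases "ln (1 - \<delta>) = - \<delta>") auto
  ultimately have \<gamma>: "\<gamma> > 0"
    using \<delta> by (simp add: \<gamma>_def)
  have \<gamma>_le: "\<gamma> \<le> (\<delta> - ln (1 + \<delta>)) / 2" "\<gamma> \<le> (- \<delta> - ln (1 - \<delta>)) / 4" "\<gamma> \<le> \<delta> / 12"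
    unfolding \<gamma>_def by (intro Min_le; simp)+
  define \<kappa> where "\<kappa> = (1 - c) * L / 4"
  have \<kappa>: "\<kappa> > 0"
    using c L by (simp add: \<kappa>_def)
  have exp_lim: "(\<lambda>m. exp (- (real (n m) * \<alpha>))) \<longlonglongrightarrow> 0" if "\<alpha> > 0" for \<alpha>
    using filterlim_tendsto_pos_mult_at_top[OF tendsto_const that n_top]
    by (intro filterlim_compose[OF exp_at_bot]) (simp add: filterlim_uminus_at_bot mult.commute)
  have lim: "(\<lambda>m. 3 * exp (- (real (n m) * \<gamma>)) + 2 / \<kappa> * exp (- (real (n m) * (\<kappa> / 2)))) \<longlonglongrightarrow> 0"
    using \<gamma> \<kappa> by (intro tendsto_add_zero tendsto_mult_right_zero exp_lim) auto
  show ?thesis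
  proof (rule tendsto_sandwich[OF _ _ tendsto_const lim])
    show "\<forall>\<^sub>F m in sequentially. 0 \<le> error_bound \<delta> x (n m) m (k m)"
      unfolding error_bound_def by (intro always_eventually allI add_nonneg_nonneg sum_nonneg mult_nonneg_nonneg) auto
    show "\<forall>\<^sub>F m in sequentially. error_bound \<delta> x (n m) m (k m)
        \<le> 3 * exp (- (real (n m) * \<gamma>)) + 2 / \<kappa> * exp (- (real (n m) * (\<kappa> / 2)))"
      using rate small[OF \<gamma>] small[of 1, simplified]
    proof eventually_elim
      case (elim m)
      have "error_bound \<delta> x (n m) m (k m) \<le> 3 * exp (- (real (n m) * \<gamma>)) + real (n m) * exp (- (real (n m) * \<kappa>))"
        unfolding \<kappa>_def L_def
        by (rule error_bound_le) (use elim x c \<delta> \<gamma>_le in auto)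
      moreover have "real (n m) * exp (- (real (n m) * \<kappa>)) \<le> 2 / \<kappa> * exp (- (real (n m) * (\<kappa> / 2)))"
      proof -
        \<comment> \<open>Half of the exponent absorbs the factor \<open>n\<close>, by
          \<open>y \<le> exp y\<close>.\<close>
        let ?y = "real (n m) * (\<kappa> / 2)"
        have "real (n m) = 2 / \<kappa> * ?y"
          using \<kappa> by simp
        also have "\<dots> \<le> 2 / \<kappa> * exp ?y"
        proof (intro mult_left_mono)
          show "?y \<le> exp ?y"
            using exp_ge_add_one_self[of ?y] by linarith
        qed (use \<kappa> in auto)
        finally have "real (n m) * exp (- (real (n m) * \<kappa>)) \<le> 2 / \<kappa> * exp ?y * exp (- (real (n m) * \<kappa>))"
          by (intro mult_right_mono) auto
        also have "\<dots> = 2 / \<kappa> * exp (?y + - (real (n m) * \<kappa>))"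
          unfolding exp_add by (simp only: mult.assoc)
        also have "?y + - (real (n m) * \<kappa>) = - ?y"
          by (simp add: field_simps)
        finally show ?thesis .
      qed
      ultimately show ?case by linarith
    qed
  qed
qed

section \<open>The decoder\<close>

text \<open>Transfers the failure bound from the single array, where noise is a column, to the pair
  of matrix and noise in \<open>model\<close>. Restrictions to disjoint index sets are independent,
  and dropping the constant column index \<open>0\<close> is a reindexing.\<close>

lemma distr_noise_and_matrix:
  fixes \<sigma>\<^sub>a \<sigma>\<^sub>z :: real and n m :: nat
  assumes pos: "\<sigma>\<^sub>a > 0" "\<sigma>\<^sub>z > 0" "n > 0"
  defines "MA \<equiv> Pi\<^sub>M ({1..n} \<times> {1..m}) (\<lambda>_. gaussian \<sigma>\<^sub>a)" and "MZ \<equiv> Pi\<^sub>M {1..n} (\<lambda>_. gaussian \<sigma>\<^sub>z)"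
  shows "distr (noise_and_matrix \<sigma>\<^sub>a \<sigma>\<^sub>z n m) (MA \<Otimes>\<^sub>M MZ)
      (\<lambda>\<omega>. (restrict \<omega> ({1..n} \<times> {1..m}), \<lambda>i\<in>{1..n}. \<omega> (i, 0))) = MA \<Otimes>\<^sub>M MZ"
    and "(\<lambda>\<omega>. (restrict \<omega> ({1..n} \<times> {1..m}), \<lambda>i\<in>{1..n}. \<omega> (i, 0))) \<in> noise_and_matrix \<sigma>\<^sub>a \<sigma>\<^sub>z n m \<rightarrow>\<^sub>M MA \<Otimes>\<^sub>M MZ"
proof -
  let ?N = "noise_and_matrix \<sigma>\<^sub>a \<sigma>\<^sub>z n m"
  let ?M = "\<lambda>j::nat \<times> nat. gaussian (if snd j = 0 then \<sigma>\<^sub>z else \<sigma>\<^sub>a)"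
  let ?I = "{1..n} \<times> {0..m}" and ?A = "{1..n} \<times> {1..m}" and ?Z = "{1..n} \<times> {0::nat}"
  let ?f = "\<lambda>\<omega> :: nat \<times> nat \<Rightarrow> real. restrict \<omega> ?A" and ?h = "\<lambda>\<omega> :: nat \<times> nat \<Rightarrow> real. restrict \<omega> ?Z"
    and ?g = "\<lambda>\<omega>. \<lambda>i\<in>{1..n}. \<omega> (i, 0::nat) :: real"
  have ps: "prob_space (?M j)" for j
    using pos by (intro prob_space_gaussian) auto
  interpret prob_space ?N
    unfolding noise_and_matrix_def by (intro prob_space_PiM ps)
  have MA: "Pi\<^sub>M ?A ?M = MA"
    unfolding MA_def by (intro PiM_cong) auto
  have ne: "?I \<noteq> {}" using pos by auto
  have "indep_vars ?M (\<lambda>j \<omega>. \<omega> j) ?I"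
    unfolding noise_and_matrix_def by (rule indep_vars_PiM_coordinates[OF ps ne])
  then have "indep_var (Pi\<^sub>M ?A ?M) (\<lambda>\<omega>. restrict (\<lambda>j. \<omega> j) ?A) (Pi\<^sub>M ?Z ?M) (\<lambda>\<omega>. restrict (\<lambda>j. \<omega> j) ?Z)"
    by (rule indep_var_restrict) auto
  then have rv: "random_variable MA ?f" "random_variable (Pi\<^sub>M ?Z ?M) ?h"
    and eq: "distr ?N MA ?f \<Otimes>\<^sub>M distr ?N (Pi\<^sub>M ?Z ?M) ?h = distr ?N (MA \<Otimes>\<^sub>M Pi\<^sub>M ?Z ?M) (\<lambda>\<omega>. (?f \<omega>, ?h \<omega>))"
    unfolding indep_var_distribution_eq MA by auto
  have "(\<lambda>j. j) \<in> ?A \<rightarrow> ?I"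
    by auto
  then have dA: "distr ?N MA ?f = MA"
    using distr_PiM_reindex[of ?I ?M "\<lambda>j. j" ?A] ps
    by (simp add: noise_and_matrix_def MA[symmetric] subset_eq)
  have "(\<lambda>j. j) \<in> ?Z \<rightarrow> ?I"
    by auto
  then have dZ: "distr ?N (Pi\<^sub>M ?Z ?M) ?h = Pi\<^sub>M ?Z ?M"
    using distr_PiM_reindex[of ?I ?M "\<lambda>j. j" ?Z] ps
    by (simp add: noise_and_matrix_def subset_eq)
  have g: "?g \<in> Pi\<^sub>M ?Z ?M \<rightarrow>\<^sub>M MZ"
    unfolding MZ_def
  proof (intro measurable_restrict)
    fix i assume "i \<in> {1..n}"
    then show "(\<lambda>\<omega>. \<omega> (i, 0)) \<in> Pi\<^sub>M ?Z ?M \<rightarrow>\<^sub>M gaussian \<sigma>\<^sub>z"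
      using measurable_component_singleton[of "(i, 0)" ?Z ?M] by simp
  qed
  have dg: "distr (Pi\<^sub>M ?Z ?M) MZ ?g = MZ"
    using distr_PiM_reindex[of ?Z ?M "\<lambda>i. (i, 0)" "{1..n}"] ps
    by (simp add: MZ_def inj_on_def)
  have "prob_space MZ"
    unfolding MZ_def using pos by (intro prob_space_PiM prob_space_gaussian)
  then interpret MZ: prob_space MZ .
  have sf: "sigma_finite_measure (distr (Pi\<^sub>M ?Z ?M) MZ ?g)"
    unfolding dg by unfold_locales
  have gh: "?g (?h \<omega>) = ?g \<omega>" for \<omega> :: "nat \<times> nat \<Rightarrow> real"
    by (auto simp: fun_eq_iff)
  have idA: "(\<lambda>x. x) \<in> MA \<rightarrow>\<^sub>M MA" by simp
  have "?g \<in> ?N \<rightarrow>\<^sub>M MZ"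
    using measurable_compose[OF rv(2) g] unfolding gh .
  then show "(\<lambda>\<omega>. (?f \<omega>, ?g \<omega>)) \<in> ?N \<rightarrow>\<^sub>M MA \<Otimes>\<^sub>M MZ"
    using rv(1) by (intro measurable_Pair)
  have "MA \<Otimes>\<^sub>M MZ = distr MA MA (\<lambda>x. x) \<Otimes>\<^sub>M distr (Pi\<^sub>M ?Z ?M) MZ ?g"
    unfolding dg by simp
  also have "\<dots> = distr (MA \<Otimes>\<^sub>M Pi\<^sub>M ?Z ?M) (MA \<Otimes>\<^sub>M MZ) (\<lambda>(x, y). (x, ?g y))"
    by (rule pair_measure_distr[OF idA g sf])
  also have "MA \<Otimes>\<^sub>M Pi\<^sub>M ?Z ?M = distr ?N (MA \<Otimes>\<^sub>M Pi\<^sub>M ?Z ?M) (\<lambda>\<omega>. (?f \<omega>, ?h \<omega>))"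
    using eq unfolding dA dZ .
  also have "distr \<dots> (MA \<Otimes>\<^sub>M MZ) (\<lambda>(x, y). (x, ?g y)) = distr ?N (MA \<Otimes>\<^sub>M MZ) (\<lambda>\<omega>. (?f \<omega>, ?g (?h \<omega>)))"
    using rv g by (subst distr_distr) (auto simp: o_def intro!: measurable_Pair measurable_compose[OF measurable_snd g])
  finally show "distr ?N (MA \<Otimes>\<^sub>M MZ) (\<lambda>\<omega>. (?f \<omega>, ?g \<omega>)) = MA \<Otimes>\<^sub>M MZ"
    unfolding gh by simp
qed

text \<open>Averaging over the support: conditionally on each value \<open>t\<close> the bound is
  \<open>b\<close>, and the weights \<open>1 / card T\<close> add up to 1. \<open>E\<close> is
  estimated through the measurable cover by the \<open>B t\<close>, so it suffices to locate the
  decoder's errors inside the sets \<open>G t\<close>.\<close>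

lemma emeasure_pair_uniform_middle_le:
  assumes M: "prob_space M1" "prob_space M2" and T: "finite T" "T \<noteq> {}"
    and G: "\<And>t. t \<in> T \<Longrightarrow> G t \<in> sets (M1 \<Otimes>\<^sub>M M2)" "\<And>t. t \<in> T \<Longrightarrow> emeasure (M1 \<Otimes>\<^sub>M M2) (G t) \<le> b"
    and E: "\<And>a t z. (a, t, z) \<in> E \<Longrightarrow> t \<in> T \<and> (a, z) \<in> G t"
  shows "emeasure (M1 \<Otimes>\<^sub>M (uniform_count_measure T \<Otimes>\<^sub>M M2)) E \<le> b"
proof -
  let ?U = "uniform_count_measure T"
  let ?M = "M1 \<Otimes>\<^sub>M (?U \<Otimes>\<^sub>M M2)"
  interpret M1: prob_space M1 by fact
  interpret M2: prob_space M2 by fact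
  interpret U: prob_space ?U by (intro prob_space_uniform_count_measure T)
  interpret UM2: pair_prob_space ?U M2 ..
  define B where "B t = {(a, s, z) | a s z. s = t \<and> (a, z) \<in> G t}" for t
  have Bsets: "B t \<in> sets ?M" and Bm: "emeasure ?M (B t) = ennreal (1 / real (card T)) * emeasure (M1 \<Otimes>\<^sub>M M2) (G t)"
    if t: "t \<in> T" for t
  proof -
    have f: "(\<lambda>x. (fst x, snd (snd x))) \<in> ?M \<rightarrow>\<^sub>M M1 \<Otimes>\<^sub>M M2"
      by measurable
    have g: "(\<lambda>x. fst (snd x)) \<in> ?M \<rightarrow>\<^sub>M ?U"
      by measurable
    have tU: "{t} \<in> sets ?U"
      using t by (simp add: sets_uniform_count_measure)
    have "B t = ((\<lambda>x. (fst x, snd (snd x))) -` G t \<inter> space ?M) \<inter> ((\<lambda>x. fst (snd x)) -` {t} \<inter> space ?M)"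
      using sets.sets_into_space[OF G(1)[OF t]] t
      by (auto simp: B_def space_pair_measure space_uniform_count_measure)
    then show Bs: "B t \<in> sets ?M"
      using measurable_sets[OF f G(1)[OF t]] measurable_sets[OF g tU] by simp
    have "emeasure ?M (B t) = (\<integral>\<^sup>+a. emeasure (?U \<Otimes>\<^sub>M M2) (Pair a -` B t) \<partial>M1)"
      by (rule UM2.emeasure_pair_measure_alt[OF Bs])
    also have "\<dots> = (\<integral>\<^sup>+a. ennreal (1 / real (card T)) * emeasure M2 (Pair a -` G t) \<partial>M1)"
    proof (intro nn_integral_cong)
      fix a
      have "Pair a -` B t = {t} \<times> (Pair a -` G t)"
        by (auto simp: B_def)
      then have "emeasure (?U \<Otimes>\<^sub>M M2) (Pair a -` B t) = emeasure ?U {t} * emeasure M2 (Pair a -` G t)"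
        using tU sets_Pair1[OF G(1)[OF t]] by (simp add: M2.emeasure_pair_measure_Times)
      then show "emeasure (?U \<Otimes>\<^sub>M M2) (Pair a -` B t) = ennreal (1 / real (card T)) * emeasure M2 (Pair a -` G t)"
        using t T by (simp add: emeasure_uniform_count_measure)
    qed
    also have "\<dots> = ennreal (1 / real (card T)) * (\<integral>\<^sup>+a. emeasure M2 (Pair a -` G t) \<partial>M1)"
      by (intro nn_integral_cmult M2.measurable_emeasure_Pair G t)
    also have "(\<integral>\<^sup>+a. emeasure M2 (Pair a -` G t) \<partial>M1) = emeasure (M1 \<Otimes>\<^sub>M M2) (G t)"
      by (rule M2.emeasure_pair_measure_alt[OF G(1)[OF t], symmetric])
    finally show "emeasure ?M (B t) = ennreal (1 / real (card T)) * emeasure (M1 \<Otimes>\<^sub>M M2) (G t)" .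
  qed
  have "emeasure ?M E \<le> emeasure ?M (\<Union>t\<in>T. B t)"
    using E T Bsets by (intro emeasure_mono sets.finite_UN) (auto simp: B_def)
  also have "\<dots> \<le> (\<Sum>t\<in>T. emeasure ?M (B t))"
    using T Bsets by (intro emeasure_subadditive_finite) auto
  also have "\<dots> \<le> (\<Sum>t\<in>T. ennreal (1 / real (card T)) * b)"
    using Bm G(2) by (intro sum_mono) (simp add: mult_left_mono)
  also have "\<dots> = of_nat (card T) * ennreal (1 / real (card T)) * b"
    by (simp add: mult.assoc)
  also have "of_nat (card T) * ennreal (1 / real (card T)) = 1"
    using T by (simp add: ennreal_of_nat_eq_real_of_nat ennreal_mult[symmetric])
  finally show ?thesis by simp
qed

text \<open>A nested conditional over finitely many measurable tests, with \<open>b\<close> as the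
  last resort.\<close>

lemma measurable_selection_finite:
  assumes "finite T" "\<And>t. t \<in> T \<Longrightarrow> {z \<in> space M. P t z} \<in> sets M" "\<And>t. t \<in> T \<Longrightarrow> g t \<in> B" "b \<in> B"
  shows "\<exists>d \<in> M \<rightarrow>\<^sub>M count_space B. \<forall>z \<in> space M. (\<exists>t\<in>T. P t z) \<longrightarrow> (\<exists>t\<in>T. P t z \<and> d z = g t)"
  using assms
proof (induction T rule: finite_induct)
  case empty
  then show ?case by (intro bexI[of _ "\<lambda>_. b"]) auto
next
  case (insert t T)
  then obtain d where d: "d \<in> M \<rightarrow>\<^sub>M count_space B" "\<forall>z \<in> space M. (\<exists>t\<in>T. P t z) \<longrightarrow> (\<exists>t\<in>T. P t z \<and> d z = g t)"
    by auto
  have "(\<lambda>z. if P t z then g t else d z) \<in> M \<rightarrow>\<^sub>M count_space B"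
    using insert.prems by (intro measurable_If d) auto
  then show ?case
    using d(2) by (intro bexI[of _ "\<lambda>z. if P t z then g t else d z"]) auto
qed

text \<open>The decoder returns the index set of some accepted tuple. If the true tuple is accepted
  and no tuple with another index set is, every possible choice is correct; \<open>G S\<close> is
  the complementary event when \<open>S\<close> is true.\<close>

lemma support_recovery_map_exists:
  fixes w :: "nat \<Rightarrow> real"
  assumes pos: "\<sigma>\<^sub>a > 0" "\<sigma>\<^sub>z > 0" "n > 0" and \<delta>: "0 < \<delta>" "2 * \<delta> \<le> 1"
    and w: "\<And>j. j \<in> {1..k} \<Longrightarrow> w\<^sub>0 \<le> \<bar>w j\<bar>" "w\<^sub>0 > 0" and k: "k \<le> m"
  shows "\<exists>d. support_recovery_map n m d \<and>
    \<P>((A, S, Z) in model \<sigma>\<^sub>a \<sigma>\<^sub>z n m k. d (measurement n m A (signal m k w S) Z) A \<noteq> supp m (signal m k w S))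
      \<le> error_bound \<delta> (w\<^sub>0\<^sup>2 * \<sigma>\<^sub>a\<^sup>2 / \<sigma>\<^sub>z\<^sup>2) n m k"
proof -
  define MA where "MA = Pi\<^sub>M ({1..n} \<times> {1..m}) (\<lambda>_. gaussian \<sigma>\<^sub>a)"
  define MZ where "MZ = Pi\<^sub>M {1..n} (\<lambda>_. gaussian \<sigma>\<^sub>z)"
  let ?T = "injective_tuples k m" and ?V = "vec_borel n \<Otimes>\<^sub>M mat_borel n m"
  let ?N = "noise_and_matrix \<sigma>\<^sub>a \<sigma>\<^sub>z n m"
  define X where "X = signal m k w"
  define P where "P S = (\<lambda>(y :: nat \<Rightarrow> real, A). (\<Sum>i\<in>{1..n}. (y i - (\<Sum>s\<in>{1..m}. A (i, s) * X S s))\<^sup>2) \<le> real n * \<sigma>\<^sub>z\<^sup>2 * (1 + \<delta>))"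
    for S
  define Y where "Y S = (\<lambda>(A, Z). (measurement n m A (X S) Z, A))" for S
  define G where "G S = {z \<in> space (MA \<Otimes>\<^sub>M MZ). \<not> P S (Y S z) \<or> (\<exists>S'\<in>?T. S' ` {1..k} \<noteq> S ` {1..k} \<and> P S' (Y S z))}" for S
  have sets_MA: "sets MA = sets (mat_borel n m)"
    by (simp add: MA_def mat_borel_def sets_PiM_gaussian)
  have comp_y: "(\<lambda>z. fst z i) \<in> borel_measurable ?V" if "i \<in> {1..n}" for i
    using that measurable_compose[OF measurable_fst measurable_component_singleton[of i "{1..n}" "\<lambda>_. borel"]]
    by (simp add: vec_borel_def)
  have comp_A: "(\<lambda>z. snd z (i, s)) \<in> borel_measurable ?V" if "i \<in> {1..n}" "s \<in> {1..m}" for i s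
    using that measurable_compose[OF measurable_snd measurable_component_singleton[of "(i, s)" "{1..n} \<times> {1..m}" "\<lambda>_. borel"]]
    by (simp add: mat_borel_def)
  have P_sets: "{z \<in> space ?V. P S z} \<in> sets ?V" for S
  proof -
    have "(\<lambda>z. \<Sum>i\<in>{1..n}. (fst z i - (\<Sum>s\<in>{1..m}. snd z (i, s) * X S s))\<^sup>2) \<in> borel_measurable ?V"
      by (intro borel_measurable_sum borel_measurable_power borel_measurable_diff borel_measurable_times comp_y comp_A) auto
    then show ?thesis
      unfolding P_def case_prod_beta by measurable
  qed
  have Y_meas: "Y S \<in> MA \<Otimes>\<^sub>M MZ \<rightarrow>\<^sub>M ?V" for S
  proof -
    have A: "(\<lambda>z. fst z (i, s)) \<in> borel_measurable (MA \<Otimes>\<^sub>M MZ)" if "i \<in> {1..n}" "s \<in> {1..m}" for i s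
      using that measurable_compose[OF measurable_fst measurable_component_singleton[of "(i, s)" "{1..n} \<times> {1..m}" "\<lambda>_. gaussian \<sigma>\<^sub>a"]]
      by (simp add: MA_def cong: measurable_cong_sets)
    have Z: "(\<lambda>z. snd z i) \<in> borel_measurable (MA \<Otimes>\<^sub>M MZ)" if "i \<in> {1..n}" for i
      using that measurable_compose[OF measurable_snd measurable_component_singleton[of i "{1..n}" "\<lambda>_. gaussian \<sigma>\<^sub>z"]]
      by (simp add: MZ_def cong: measurable_cong_sets)
    have "(\<lambda>z. measurement n m (fst z) (X S) (snd z)) \<in> MA \<Otimes>\<^sub>M MZ \<rightarrow>\<^sub>M vec_borel n"
      unfolding measurement_def vec_borel_def
      by (intro measurable_restrict borel_measurable_add borel_measurable_sum borel_measurable_times A Z) auto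
    moreover have "fst \<in> MA \<Otimes>\<^sub>M MZ \<rightarrow>\<^sub>M mat_borel n m"
      using measurable_fst[of MA MZ] by (simp add: sets_MA cong: measurable_cong_sets)
    ultimately show ?thesis
      unfolding Y_def case_prod_beta by (intro measurable_Pair)
  qed
  have PY: "{z \<in> space (MA \<Otimes>\<^sub>M MZ). P S' (Y S z)} \<in> sets (MA \<Otimes>\<^sub>M MZ)" for S S'
  proof -
    have "{z \<in> space (MA \<Otimes>\<^sub>M MZ). P S' (Y S z)} = Y S -` {z \<in> space ?V. P S' z} \<inter> space (MA \<Otimes>\<^sub>M MZ)"
      using measurable_space[OF Y_meas] by auto
    then show ?thesis
      using measurable_sets[OF Y_meas P_sets] by simp
  qed
  have G_sets: "G S \<in> sets (MA \<Otimes>\<^sub>M MZ)" for S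
  proof -
    have "G S = (space (MA \<Otimes>\<^sub>M MZ) - {z \<in> space (MA \<Otimes>\<^sub>M MZ). P S (Y S z)})
        \<union> (\<Union>S'\<in>{S'\<in>?T. S' ` {1..k} \<noteq> S ` {1..k}}. {z \<in> space (MA \<Otimes>\<^sub>M MZ). P S' (Y S z)})"
      by (auto simp: G_def)
    also have "\<dots> \<in> sets (MA \<Otimes>\<^sub>M MZ)"
      by (intro sets.Un sets.Diff sets.finite_UN PY sets.top) (simp add: finite_injective_tuples)
    finally show ?thesis .
  qed
  obtain d where d: "d \<in> ?V \<rightarrow>\<^sub>M count_space (Pow {1..m})"
    and dP: "\<And>z. z \<in> space ?V \<Longrightarrow> \<exists>S\<in>?T. P S z \<Longrightarrow> \<exists>S\<in>?T. P S z \<and> d z = S ` {1..k}"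
  proof -
    \<comment> \<open>If no tuple is accepted, the arbitrary default \<open>{}\<close> is harmless:
      the true tuple is then rejected too, which \<open>G\<close> already counts as a
      failure.\<close>
    have "\<exists>d \<in> ?V \<rightarrow>\<^sub>M count_space (Pow {1..m}). \<forall>z \<in> space ?V. (\<exists>S\<in>?T. P S z) \<longrightarrow> (\<exists>S\<in>?T. P S z \<and> d z = S ` {1..k})"
      by (rule measurable_selection_finite[OF finite_injective_tuples P_sets, where b="{}"]) (auto simp: injective_tuples_def)
    then show ?thesis using that by blast
  qed
  have G_le: "emeasure (MA \<Otimes>\<^sub>M MZ) (G S) \<le> ennreal (error_bound \<delta> (w\<^sub>0\<^sup>2 * \<sigma>\<^sub>a\<^sup>2 / \<sigma>\<^sub>z\<^sup>2) n m k)" if S: "S \<in> ?T" for S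
  proof -
    let ?\<phi> = "\<lambda>\<omega>. (restrict \<omega> ({1..n} \<times> {1..m}), \<lambda>i\<in>{1..n}. \<omega> (i, 0))"
    note distr = distr_noise_and_matrix[OF pos, of m, folded MA_def MZ_def]
    have P_\<phi>: "P S' (Y S (?\<phi> \<omega>)) \<longleftrightarrow> (\<Sum>i\<in>{1..n}. (\<omega> (i, 0) + (\<Sum>s\<in>{1..m}. (X S s - X S' s) * \<omega> (i, s)))\<^sup>2)
        \<le> real n * \<sigma>\<^sub>z\<^sup>2 * (1 + \<delta>)" for S' \<omega>
    proof -
      have "(\<Sum>i\<in>{1..n}. (measurement n m (fst (?\<phi> \<omega>)) (X S) (snd (?\<phi> \<omega>)) i - (\<Sum>s\<in>{1..m}. fst (?\<phi> \<omega>) (i, s) * X S' s))\<^sup>2)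
          = (\<Sum>i\<in>{1..n}. (\<omega> (i, 0) + (\<Sum>s\<in>{1..m}. (X S s - X S' s) * \<omega> (i, s)))\<^sup>2)"
      proof (intro sum.cong refl)
        fix i assume i: "i \<in> {1..n}"
        have "(\<Sum>s\<in>{1..m}. (X S s - X S' s) * \<omega> (i, s)) = (\<Sum>s\<in>{1..m}. \<omega> (i, s) * X S s) - (\<Sum>s\<in>{1..m}. \<omega> (i, s) * X S' s)"
          by (simp add: algebra_simps sum_subtractf)
        then have "measurement n m (fst (?\<phi> \<omega>)) (X S) (snd (?\<phi> \<omega>)) i - (\<Sum>s\<in>{1..m}. fst (?\<phi> \<omega>) (i, s) * X S' s)
          = \<omega> (i, 0) + (\<Sum>s\<in>{1..m}. (X S s - X S' s) * \<omega> (i, s))"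
          using i by (simp add: measurement_def)
        then show "(measurement n m (fst (?\<phi> \<omega>)) (X S) (snd (?\<phi> \<omega>)) i - (\<Sum>s\<in>{1..m}. fst (?\<phi> \<omega>) (i, s) * X S' s))\<^sup>2
          = (\<omega> (i, 0) + (\<Sum>s\<in>{1..m}. (X S s - X S' s) * \<omega> (i, s)))\<^sup>2"
          by (rule arg_cong)
      qed
      then show ?thesis
        by (simp add: P_def Y_def)
    qed
    have "emeasure (MA \<Otimes>\<^sub>M MZ) (G S) = emeasure (distr ?N (MA \<Otimes>\<^sub>M MZ) ?\<phi>) (G S)"
      unfolding distr(1) ..
    also have "\<dots> = emeasure ?N (?\<phi> -` G S \<inter> space ?N)"
      by (rule emeasure_distr[OF distr(2) G_sets])
    also have "?\<phi> -` G S \<inter> space ?N = {\<omega> \<in> space ?N. \<not> P S (Y S (?\<phi> \<omega>))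
        \<or> (\<exists>S'\<in>?T. S' ` {1..k} \<noteq> S ` {1..k} \<and> P S' (Y S (?\<phi> \<omega>)))}"
      using measurable_space[OF distr(2)] unfolding G_def by auto
    also have "emeasure ?N \<dots> \<le> ennreal (error_bound \<delta> (w\<^sub>0\<^sup>2 * \<sigma>\<^sub>a\<^sup>2 / \<sigma>\<^sub>z\<^sup>2) n m k)"
      unfolding P_\<phi> X_def by (rule emeasure_decoding_failure_le[OF pos \<delta> w S])
    finally show ?thesis .
  qed
  let ?E = "{x \<in> space (model \<sigma>\<^sub>a \<sigma>\<^sub>z n m k). case x of (A, S, Z) \<Rightarrow> d (measurement n m A (X S) Z, A) \<noteq> supp m (X S)}"
  have "emeasure (model \<sigma>\<^sub>a \<sigma>\<^sub>z n m k) ?E \<le> ennreal (error_bound \<delta> (w\<^sub>0\<^sup>2 * \<sigma>\<^sub>a\<^sup>2 / \<sigma>\<^sub>z\<^sup>2) n m k)"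
    unfolding model_def MA_def[symmetric] MZ_def[symmetric]
  proof (rule emeasure_pair_uniform_middle_le[where G=G])
    show "prob_space MA" "prob_space MZ"
      unfolding MA_def MZ_def using pos by (auto intro!: prob_space_PiM prob_space_gaussian)
    show "?T \<noteq> {}"
      by (rule injective_tuples_nonempty[OF k])
    fix A S Z
    assume "(A, S, Z) \<in> {x \<in> space (MA \<Otimes>\<^sub>M (uniform_count_measure ?T \<Otimes>\<^sub>M MZ)). case x of (A, S, Z) \<Rightarrow> d (measurement n m A (X S) Z, A) \<noteq> supp m (X S)}"
    then have S: "S \<in> ?T" and AZ: "(A, Z) \<in> space (MA \<Otimes>\<^sub>M MZ)"
      and err: "d (Y S (A, Z)) \<noteq> supp m (X S)"
      by (auto simp: space_pair_measure space_uniform_count_measure Y_def)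
    have "supp m (X S) = S ` {1..k}"
      unfolding X_def using w by (intro supp_signal S) fastforce
    \<comment> \<open>The selected tuple is itself accepted, and the error means that its index set
      is not the true one.\<close>
    have "\<exists>S'\<in>?T. S' ` {1..k} \<noteq> S ` {1..k} \<and> P S' (Y S (A, Z))" if P: "P S (Y S (A, Z))"
    proof -
      have "\<exists>S'\<in>?T. P S' (Y S (A, Z))"
        using P S by blast
      from dP[OF measurable_space[OF Y_meas AZ] this] show ?thesis
        using err \<open>supp m (X S) = S ` {1..k}\<close> by metis
    qed
    then have "(A, Z) \<in> G S"
      using AZ unfolding G_def by blast
    with S show "S \<in> ?T \<and> (A, Z) \<in> G S" ..
  qed (simp_all add: finite_injective_tuples G_sets G_le)
  then have "measure (model \<sigma>\<^sub>a \<sigma>\<^sub>z n m k) ?E \<le> error_bound \<delta> (w\<^sub>0\<^sup>2 * \<sigma>\<^sub>a\<^sup>2 / \<sigma>\<^sub>z\<^sup>2) n m k"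
    unfolding measure_def by (intro enn2real_leI error_bound_nonneg)
  moreover have E: "?E = {(A, S, Z). (A, S, Z) \<in> space (model \<sigma>\<^sub>a \<sigma>\<^sub>z n m k) \<and> d (measurement n m A (X S) Z, A) \<noteq> supp m (X S)}"
    by auto
  ultimately have "\<P>((A, S, Z) in model \<sigma>\<^sub>a \<sigma>\<^sub>z n m k. curry d (measurement n m A (signal m k w S) Z) A \<noteq> supp m (signal m k w S))
      \<le> error_bound \<delta> (w\<^sub>0\<^sup>2 * \<sigma>\<^sub>a\<^sup>2 / \<sigma>\<^sub>z\<^sup>2) n m k"
    unfolding E by (simp add: X_def)
  moreover have "support_recovery_map n m (curry d)"
    using d by (simp add: support_recovery_map_def)
  ultimately show ?thesis by blast
qed

theorem theorem3:
  fixes \<sigma>\<^sub>a \<sigma>\<^sub>z w\<^sub>m\<^sub>i\<^sub>n w\<^sub>m\<^sub>a\<^sub>x :: real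
    and k n :: "nat \<Rightarrow> nat"
    and w :: "nat \<Rightarrow> nat \<Rightarrow> real"
  assumes "\<sigma>\<^sub>a > 0" and "\<sigma>\<^sub>z > 0"
    and "0 < w\<^sub>m\<^sub>i\<^sub>n" and "w\<^sub>m\<^sub>i\<^sub>n \<le> w\<^sub>m\<^sub>a\<^sub>x"
    and "\<And>m. m \<ge> 1 \<Longrightarrow> 0 < k m \<and> k m \<le> m"
    and "\<And>m. m \<ge> 1 \<Longrightarrow> 0 < n m"
    and "\<And>m j. m \<ge> 1 \<Longrightarrow> j \<in> {1..k m} \<Longrightarrow> w\<^sub>m\<^sub>i\<^sub>n \<le> \<bar>w m j\<bar> \<and> \<bar>w m j\<bar> \<le> w\<^sub>m\<^sub>a\<^sub>x"
    and "limsup (\<lambda>m. ereal (1 / real (n m) *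
           (MAX j\<in>{1..k m}.
              (6 * real (k m) * ln (real (k m)) + 2 * real j * ln (real m))
                / ln (real j * w\<^sub>m\<^sub>i\<^sub>n\<^sup>2 * \<sigma>\<^sub>a\<^sup>2 / \<sigma>\<^sub>z\<^sup>2 + 1)))) < 1"
  shows "\<exists>d :: nat \<Rightarrow> (nat \<Rightarrow> real) \<Rightarrow> (nat \<times> nat \<Rightarrow> real) \<Rightarrow> nat set.
           (\<forall>m\<ge>1. support_recovery_map (n m) m (d m)) \<and>
           (\<lambda>m. \<P>((A, S, Z) in model \<sigma>\<^sub>a \<sigma>\<^sub>z (n m) m (k m).
                  d m (measurement (n m) m A (signal m (k m) (w m) S) Z) A
                    \<noteq> supp m (signal m (k m) (w m) S))) \<longlonglongrightarrow> 0"
proof -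
  define x where "x = w\<^sub>m\<^sub>i\<^sub>n\<^sup>2 * \<sigma>\<^sub>a\<^sup>2 / \<sigma>\<^sub>z\<^sup>2"
  have x: "x > 0"
    using assms(1-3) by (simp add: x_def)
  let ?f = "\<lambda>m j. (6 * real (k m) * ln (real (k m)) + 2 * real j * ln (real m))
      / ln (real j * w\<^sub>m\<^sub>i\<^sub>n\<^sup>2 * \<sigma>\<^sub>a\<^sup>2 / \<sigma>\<^sub>z\<^sup>2 + 1)"
  \<comment> \<open>A constant strictly between the limsup and 1: for large \<open>m\<close> the
    maximum, hence every \<open>j\<close>, obeys the bound with margin \<open>1 - c\<close>.\<close>
  obtain c where c: "limsup (\<lambda>m. ereal (1 / real (n m) * (MAX j\<in>{1..k m}. ?f m j))) < ereal c" "ereal c < 1"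
    using ereal_dense2[OF assms(8)] by blast
  then have c1: "c < 1" by simp
  have rate: "\<forall>\<^sub>F m in sequentially. n m > 0 \<and> k m > 0 \<and> k m \<le> m \<and> (\<forall>j\<in>{1..k m}.
      6 * real (k m) * ln (real (k m)) + 2 * real j * ln (real m) \<le> c * real (n m) * ln (1 + real j * x))"
    using Limsup_lessD[OF c(1)] eventually_ge_at_top[of 1]
  proof eventually_elim
    case (elim m)
    have nk: "n m > 0" "k m > 0" "k m \<le> m"
      using assms(5,6) elim by auto
    have "6 * real (k m) * ln (real (k m)) + 2 * real j * ln (real m) \<le> c * real (n m) * ln (1 + real j * x)"
      if j: "j \<in> {1..k m}" for j
    proof -
      define M where "M = (MAX j\<in>{1..k m}. ?f m j)"
      have "1 / real (n m) * M < c"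
        using elim(1) unfolding M_def by (simp only: less_ereal.simps)
      then have "M \<le> c * real (n m)"
        using nk by (simp add: field_simps)
      moreover have "?f m j \<le> M"
        unfolding M_def using j by (intro Max_ge) auto
      ultimately have "?f m j \<le> c * real (n m)"
        by (rule order_trans[rotated])
      moreover have eq: "real j * w\<^sub>m\<^sub>i\<^sub>n\<^sup>2 * \<sigma>\<^sub>a\<^sup>2 / \<sigma>\<^sub>z\<^sup>2 + 1 = 1 + real j * x"
        by (simp add: x_def)
      moreover have "ln (1 + real j * x) > 0"
        using x j by (intro ln_gt_zero) auto
      ultimately show ?thesis
        unfolding eq by (simp add: pos_divide_le_eq)
    qed
    with nk show ?case by blast
  qed
  \<comment> \<open>The second entry makes \<open>3 * \<delta>\<close> at most half of the margin
    \<open>(1 - c) * ln (1 + x)\<close>; the first keeps \<open>1 - 2 * \<delta>\<close>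
    nonnegative.\<close>
  define \<delta> where "\<delta> = min (1 / 2) ((1 - c) * ln (1 + x) / 6)"
  have \<delta>: "0 < \<delta>" "2 * \<delta> \<le> 1" "3 * \<delta> \<le> (1 - c) * ln (1 + x) / 2"
    using c1 x by (auto simp: \<delta>_def min_def)
  let ?P = "\<lambda>m d. support_recovery_map (n m) m d \<and>
      \<P>((A, S, Z) in model \<sigma>\<^sub>a \<sigma>\<^sub>z (n m) m (k m).
         d (measurement (n m) m A (signal m (k m) (w m) S) Z) A \<noteq> supp m (signal m (k m) (w m) S))
        \<le> error_bound \<delta> x (n m) m (k m)"
  \<comment> \<open>The choice is restricted to \<open>m \<ge> 1\<close>, where the hypotheses on
    \<open>k\<close>, \<open>n\<close> and \<open>w\<close> hold.\<close>
  have "\<forall>m\<in>{1..}. \<exists>d. ?P m d"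
    unfolding x_def using assms \<delta> by (intro ballI support_recovery_map_exists) auto
  from bchoice[OF this] obtain d where d: "\<forall>m\<in>{1..}. ?P m (d m)"
    by blast
  show ?thesis
  proof (intro exI[of _ d] conjI allI impI)
    show "support_recovery_map (n m) m (d m)" if "1 \<le> m" for m
      using d that by auto
    show "(\<lambda>m. \<P>((A, S, Z) in model \<sigma>\<^sub>a \<sigma>\<^sub>z (n m) m (k m).
        d m (measurement (n m) m A (signal m (k m) (w m) S) Z) A \<noteq> supp m (signal m (k m) (w m) S))) \<longlonglongrightarrow> 0"
    proof (rule tendsto_sandwich[OF _ _ tendsto_const error_bound_tendsto_0[OF x c1 \<delta> rate]])
      show "\<forall>\<^sub>F m in sequentially. \<P>((A, S, Z) in model \<sigma>\<^sub>a \<sigma>\<^sub>z (n m) m (k m).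
          d m (measurement (n m) m A (signal m (k m) (w m) S) Z) A \<noteq> supp m (signal m (k m) (w m) S))
          \<le> error_bound \<delta> x (n m) m (k m)"
        using eventually_ge_at_top[of 1] by eventually_elim (use d in auto)
    qed simp
  qed
qed

end
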